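(* Let $0 < \kappa < 1$, $\lambda = \sqrt{1-\kappa^2}$, and let $p_\kappa = \wp(\,\cdot\,; g_2, g_3)$ with $g_2 = \tfrac{4}{27}(8\lambda^2 + 1)$ and $g_3 = \tfrac{8}{729}(8\lambda^4 + 20\lambda^2 - 1)$. The period lattice of $p_\kappa$ is rectangular, generated by $2\omega_\kappa$ and $2\omega_\kappa'$ with $\omega_\kappa > 0$ real and $\omega_\kappa'$ purely imaginary with positive imaginary part. Then $$\omega_\kappa = \tfrac{1}{2}\pi \,_2F_1 (\tfrac{1}{3}, \tfrac{2}{3}; 1; \kappa^2) \quad\text{and}\quad \omega_\kappa' = {\rm i}\, \tfrac{\sqrt3}{2}\pi \,_2F_1 (\tfrac{1}{3}, \tfrac{2}{3}; 1; \lambda^2).$$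
   Context: $\wp(\,\cdot\,; g_2, g_3)$ denotes the Weierstrass elliptic function with invariants $g_2, g_3$; $\,_2F_1$ is the Gauss hypergeometric function. *)

theory Defs
  imports "HOL-Analysis.Analysis"
begin

definition lattice :: "complex \<Rightarrow> complex \<Rightarrow> complex set" where
  "lattice w1 w2 = {of_int m * w1 + of_int n * w2 | m n. True}"

definition weierstrass_p :: "complex set \<Rightarrow> complex \<Rightarrow> complex" where
  "weierstrass_p L z = 1 / z^2 + (\<Sum>\<^sub>\<infinity> w \<in> L - {0}. 1 / (z - w)^2 - 1 / w^2)"

definition wp_g2 :: "complex set \<Rightarrow> complex" where
  "wp_g2 L = 60 * (\<Sum>\<^sub>\<infinity> w \<in> L - {0}. 1 / w^4)"

definition wp_g3 :: "complex set \<Rightarrow> complex" where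
  "wp_g3 L = 140 * (\<Sum>\<^sub>\<infinity> w \<in> L - {0}. 1 / w^6)"

text \<open>L is the period lattice of wp(.; g2, g3), i.e. wp(.; g2, g3) = weierstrass_p L:
  L is a genuine lattice (two R-linearly independent generators) with invariants g2, g3.\<close>
definition is_period_lattice_of_wp :: "complex \<Rightarrow> complex \<Rightarrow> complex set \<Rightarrow> bool" where
  "is_period_lattice_of_wp g2 g3 L \<longleftrightarrow>
     (\<exists>w1 w2. L = lattice w1 w2 \<and> Im (w2 / w1) \<noteq> 0) \<and> wp_g2 L = g2 \<and> wp_g3 L = g3"

definition hyp2F1 :: "real \<Rightarrow> real \<Rightarrow> real \<Rightarrow> real \<Rightarrow> real" where
  "hyp2F1 a b c x =
     (\<Sum>n. pochhammer a n * pochhammer b n / (pochhammer c n * fact n) * x ^ n)"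

end

theory Submission
  imports Defs "HOL-Complex_Analysis.Complex_Analysis" "HOL-Real_Asymp.Real_Asymp"
begin

text \<open>
  On the real axis the Weierstrass function of a rectangular lattice decreases from infinity at 0 to its
  first critical point \<open>\<omega>\<close> and solves \<open>x' = - sqrt (4 x\<^sup>3 - g2 x - g3)\<close>, so \<open>\<omega>\<close> is the time this motion
  needs. For the given invariants put \<open>x = 4 v - 1 / 3\<close> and \<open>t = \<kappa>\<^sup>2 / 27\<close>; the cubic is then
  \<open>64 (4 v\<^sup>3 - (v - t)\<^sup>2)\<close>, and a trigonometric substitution expresses the time as the integral over
  \<open>{0..\<pi> / 2}\<close> of \<open>cos (\<alpha> / 3) / cos \<alpha>\<close>, where \<open>sin \<alpha> = \<kappa> sin \<theta>\<close>. Expanding the integrand in powers of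
  \<open>sin \<alpha>\<close> and integrating termwise gives the hypergeometric series. Rotating the lattice by a right angle
  replaces \<open>g3\<close> by \<open>- g3\<close>, and a 3-isogeny reduces the resulting time for \<open>\<omega>'\<close> to the previous case
  with \<open>\<kappa>\<close> and \<open>\<lambda>\<close> exchanged. For existence, every pair of invariants with positive discriminant is, up
  to scaling, of the given form for some parameter, and the ratio of the half-periods determines this
  parameter.\<close>

section \<open>The series of the trisection integrand\<close>

text \<open>The shift by 1/3 is chosen for 3-torsion: the line \<open>y = i (v - t)\<close> meets
  \<open>y^2 = 4 v^3 - (v - t)^2\<close> only at \<open>v = 0\<close>, with triple contact, so the
  points over \<open>v = 0\<close> have order 3. This is the source of the trisected angles and of
  the parameters 1/3 and 2/3. The points of order 3 become real only on the rotated curve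
  \<open>y^2 = 4 x^3 + (x + t)^2\<close>, so there the isogeny acts on a real motion and serves
  \<omega>' rather than \<omega>. The curves degenerate exactly at \<open>t = 0\<close> and
  \<open>t = 1/27\<close>; hence \<kappa>^2 = 27 t fills the unit interval, and the isogeny's
  exchange of \<open>t\<close> with \<open>1/27 - t\<close> is the exchange of \<kappa> and
  \<lambda>. Times of a motion replace period integrals because these are improper at both ends. For
  a motion it is enough that a function of the position is continuous up to the ends and has
  constant derivative between them. A solution of the equations for the half-periods in terms of
  given invariants would need the inversion of a modular function. Monotonicity of the
  hypergeometric function avoids this.\<close>

definition trisection_coeff :: "nat \<Rightarrow> real" where
  "trisection_coeff n = pochhammer (1/3) n * pochhammer (2/3) n / (pochhammer (1/2) n * fact n)"

text \<open>This is 2F1(1/3, 2/3; 1/2; x). Averaging over powers of the squared sine contributes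
  \<open>pochhammer (1/2) n / fact n\<close>, which turns the lower parameter 1/2 into the 1 of the
  theorem.\<close>

definition trisection_series :: "real \<Rightarrow> real" where
  "trisection_series x = (\<Sum>n. trisection_coeff n * x ^ n)"

lemma trisection_coeff_Suc:
  "(real n + 1) * (real n + 1/2) * trisection_coeff (Suc n)
     = (real n + 1/3) * (real n + 2/3) * trisection_coeff n"
proof -
  have "pochhammer (1/2 :: real) n \<noteq> 0"
    by (metis pochhammer_pos less_irrefl zero_less_divide_1_iff zero_less_numeral)
  moreover have "real n + 1/2 \<noteq> 0" by linarith
  moreover have "real n + 1 \<noteq> 0" by linarith
  ultimately show ?thesis
    unfolding trisection_coeff_def pochhammer_Suc fact_Suc
    by (simp add: add_ac del: of_nat_Suc) (simp add: divide_simps add_ac)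
qed

lemma trisection_coeff_bounds: "0 < trisection_coeff n" "trisection_coeff n \<le> 1"
proof -
  show pos: "0 < trisection_coeff n" for n
    unfolding trisection_coeff_def by (intro divide_pos_pos mult_pos_pos pochhammer_pos) auto
  show "trisection_coeff n \<le> 1"
  proof (induction n)
    case 0
    show ?case by (simp add: trisection_coeff_def)
  next
    case (Suc n)
    have "(real n + 1) * (real n + 1/2) * trisection_coeff (Suc n)
            \<le> (real n + 1) * (real n + 1/2) * trisection_coeff n"
      unfolding trisection_coeff_Suc using pos[of n]
      by (intro mult_right_mono) (auto simp: algebra_simps)
    moreover have "(real n + 1) * (real n + 1/2) > 0" by (intro mult_pos_pos) auto
    ultimately have "trisection_coeff (Suc n) \<le> trisection_coeff n"
      by (simp only: mult_le_cancel_left_pos)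
    with Suc show ?case by simp
  qed
qed

lemma summable_trisection_series: "\<bar>x\<bar> < 1 \<Longrightarrow> summable (\<lambda>n. trisection_coeff n * x ^ n)"
proof (rule summable_comparison_test'[of "\<lambda>n. \<bar>x\<bar> ^ n" 0])
  fix n
  show "norm (trisection_coeff n * x ^ n) \<le> \<bar>x\<bar> ^ n"
    using trisection_coeff_bounds[of n]
    by (simp add: abs_mult power_abs mult_left_le_one_le)
qed (simp add: summable_geometric)

lemma trisection_series_0: "trisection_series 0 = 1"
  unfolding trisection_series_def by (simp only: powser_zero) (simp add: trisection_coeff_def)

definition "trisection_series' x = (\<Sum>n. diffs trisection_coeff n * x ^ n)"
definition "trisection_series'' x = (\<Sum>n. diffs (diffs trisection_coeff) n * x ^ n)"

lemma trisection_series_deriv: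
  assumes "\<bar>x\<bar> < 1"
  shows "(trisection_series has_real_derivative trisection_series' x) (at x)"
    and "(trisection_series' has_real_derivative trisection_series'' x) (at x)"
proof -
  have 0: "summable (\<lambda>n. trisection_coeff n * y ^ n)" if "norm y < 1" for y
    using summable_trisection_series that by simp
  have 1: "summable (\<lambda>n. diffs trisection_coeff n * y ^ n)" if "norm y < 1" for y
    using termdiff_converges[OF that 0] .
  \<comment> \<open>Termwise differentiation at \<open>x\<close> needs convergence at a point of
    strictly larger modulus; the midpoint between the modulus of \<open>x\<close> and 1
    serves.\<close>
  define K where "K = (\<bar>x\<bar> + 1) / 2"
  have K: "norm x < norm K" "norm K < 1" using assms by (auto simp: K_def)
  show "(trisection_series has_real_derivative trisection_series' x) (at x)"
    unfolding trisection_series_def[abs_def] trisection_series'_def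
    by (rule termdiffs_strong[OF 0[OF K(2)] K(1)])
  show "(trisection_series' has_real_derivative trisection_series'' x) (at x)"
    unfolding trisection_series'_def[abs_def] trisection_series''_def
    by (rule termdiffs_strong[OF 1[OF K(2)] K(1)])
qed

text \<open>The hypergeometric equation with parameters 1/3, 2/3, 1/2. Compared coefficient by
  coefficient it is exactly the recurrence \<open>trisection_coeff_Suc\<close>.\<close>

lemma trisection_series_ode:
  assumes "\<bar>x\<bar> < 1"
  shows "x * (1 - x) * trisection_series'' x + (1/2 - 2 * x) * trisection_series' x
           = 2/9 * trisection_series x"
proof -
  let ?c = trisection_coeff
  have 0: "summable (\<lambda>n. ?c n * y ^ n)" if "norm y < 1" for y
    using summable_trisection_series that by simp
  have 1: "summable (\<lambda>n. diffs ?c n * y ^ n)" if "norm y < 1" for y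
    using termdiff_converges[OF that 0] .
  have 2: "summable (\<lambda>n. diffs (diffs ?c) n * y ^ n)" if "norm y < 1" for y
    using termdiff_converges[OF that 1] .
  have x: "norm x < 1" using assms by simp
  have s0: "(\<lambda>n. ?c n * x ^ n) sums trisection_series x"
    unfolding trisection_series_def using 0[OF x] by (rule summable_sums)
  have s1: "(\<lambda>n. diffs ?c n * x ^ n) sums trisection_series' x"
    unfolding trisection_series'_def using 1[OF x] by (rule summable_sums)
  have e: "real n * a n * x ^ (n - Suc 0) * x = real n * a n * x ^ n" for n and a :: "nat \<Rightarrow> real"
    by (cases n) auto
  have s1x: "(\<lambda>n. real n * ?c n * x ^ n) sums (trisection_series' x * x)"
    using sums_mult2[OF diffs_equiv[OF 1[OF x]], of x] unfolding trisection_series'_def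
    by (simp only: e)
  have s2x: "(\<lambda>n. real n * diffs ?c n * x ^ n) sums (trisection_series'' x * x)"
    using sums_mult2[OF diffs_equiv[OF 2[OF x]], of x] unfolding trisection_series''_def
    by (simp only: e)
  have s2xx: "(\<lambda>n. real n * (real n - 1) * ?c n * x ^ n) sums (trisection_series'' x * x * x)"
  proof -
    have "(\<lambda>n. real n * diffs ?c n * x ^ n * x) sums (trisection_series'' x * x * x)"
      by (rule sums_mult2[OF s2x])
    \<comment> \<open>After multiplication by \<open>x\<close> the summands are those of the desired
      series at \<open>Suc n\<close>; its term at 0 vanishes because of the factor
      \<open>real n\<close>.\<close>
    then have "(\<lambda>n. (\<lambda>n. real n * (real n - 1) * ?c n * x ^ n) (Suc n)) sums (trisection_series'' x * x * x)"
      by (simp add: diffs_def algebra_simps)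
    from sums_Suc[OF this] show ?thesis by simp
  qed
  have "(\<lambda>n. real n * diffs ?c n * x ^ n - real n * (real n - 1) * ?c n * x ^ n
            + 1/2 * (diffs ?c n * x ^ n) - 2 * (real n * ?c n * x ^ n) - 2/9 * (?c n * x ^ n)) sums
        (trisection_series'' x * x - trisection_series'' x * x * x + 1/2 * trisection_series' x
           - 2 * (trisection_series' x * x) - 2/9 * trisection_series x)"
    by (intro sums_diff sums_add sums_mult s0 s1 s1x s2x s2xx)
  moreover have "real n * diffs ?c n * x ^ n - real n * (real n - 1) * ?c n * x ^ n
            + 1/2 * (diffs ?c n * x ^ n) - 2 * (real n * ?c n * x ^ n) - 2/9 * (?c n * x ^ n) = 0" for n
  proof -
    have "real n * diffs ?c n * x ^ n - real n * (real n - 1) * ?c n * x ^ n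
            + 1/2 * (diffs ?c n * x ^ n) - 2 * (real n * ?c n * x ^ n) - 2/9 * (?c n * x ^ n)
          = ((real n + 1) * (real n + 1/2) * ?c (Suc n) - (real n + 1/3) * (real n + 2/3) * ?c n) * x ^ n"
      by (simp add: diffs_def field_simps) 
    then show ?thesis by (simp add: trisection_coeff_Suc)
  qed
  ultimately have "(\<lambda>n. 0) sums (trisection_series'' x * x - trisection_series'' x * x * x + 1/2 * trisection_series' x
           - 2 * (trisection_series' x * x) - 2/9 * trisection_series x)" by (simp only:)
  then have "trisection_series'' x * x - trisection_series'' x * x * x + 1/2 * trisection_series' x
           - 2 * (trisection_series' x * x) - 2/9 * trisection_series x = 0"
    using sums_unique2 sums_zero by blast
  then show ?thesis by (simp add: algebra_simps)
qed

text \<open>The substitution \<open>x = sin\<^sup>2 \<alpha>\<close> turns the hypergeometric equation into \<open>G'' = - G / 9\<close>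
  for \<open>G \<alpha> = trisection_series (sin\<^sup>2 \<alpha>) * cos \<alpha>\<close>.\<close>

lemma trisection_series_sin:
  assumes "\<bar>\<alpha>\<bar> < pi / 2"
  shows "trisection_series ((sin \<alpha>)\<^sup>2) * cos \<alpha> = cos (\<alpha> / 3)"
proof -
  define K where "K \<beta> = trisection_series ((sin \<beta>)\<^sup>2) * cos \<beta> - cos (\<beta> / 3)" for \<beta>
  define K1 where "K1 \<beta> = 2 * sin \<beta> * (cos \<beta>)\<^sup>2 * trisection_series' ((sin \<beta>)\<^sup>2)
      - sin \<beta> * trisection_series ((sin \<beta>)\<^sup>2) + sin (\<beta> / 3) / 3" for \<beta>
  have x: "\<bar>(sin \<beta>)\<^sup>2\<bar> < 1" if "\<bar>\<beta>\<bar> < pi / 2" for \<beta>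
  proof -
    have "cos \<beta> > 0" using that by (intro cos_gt_zero_pi) auto
    then have "(cos \<beta>)\<^sup>2 > 0" by simp
    then show ?thesis using sin_cos_squared_add[of \<beta>] unfolding abs_power2 by linarith
  qed
  have sq: "((\<lambda>\<beta>. (sin \<beta>)\<^sup>2) has_real_derivative 2 * sin \<beta> * cos \<beta>) (at \<beta>)" for \<beta> :: real
    by (rule derivative_eq_intros refl)+ (simp add: power2_eq_square)
  have dS: "((\<lambda>\<beta>. trisection_series ((sin \<beta>)\<^sup>2)) has_real_derivative
        trisection_series' ((sin \<beta>)\<^sup>2) * (2 * sin \<beta> * cos \<beta>)) (at \<beta>)"
       "((\<lambda>\<beta>. trisection_series' ((sin \<beta>)\<^sup>2)) has_real_derivative
        trisection_series'' ((sin \<beta>)\<^sup>2) * (2 * sin \<beta> * cos \<beta>)) (at \<beta>)"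
    if "\<bar>\<beta>\<bar> < pi / 2" for \<beta>
    using DERIV_chain2[OF trisection_series_deriv(1)[OF x[OF that]] sq]
          DERIV_chain2[OF trisection_series_deriv(2)[OF x[OF that]] sq] by auto
  have dK: "(K has_real_derivative K1 \<beta>) (at \<beta>)" if "\<bar>\<beta>\<bar> < pi / 2" for \<beta>
    unfolding K_def[abs_def] K1_def
    by (rule DERIV_cong, (rule derivative_intros dS[OF that] numeral_neq_zero)+) (simp_all add: power2_eq_square algebra_simps)
  have dK1: "(K1 has_real_derivative - K \<beta> / 9) (at \<beta>)" if "\<bar>\<beta>\<bar> < pi / 2" for \<beta>
  proof -
    let ?s = "sin \<beta>" and ?c = "cos \<beta>"
    let ?S = "trisection_series (?s\<^sup>2)" and ?S1 = "trisection_series' (?s\<^sup>2)" and ?S2 = "trisection_series'' (?s\<^sup>2)"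
    have cc: "?c\<^sup>2 = 1 - ?s\<^sup>2" by (simp add: cos_squared_eq)
    have d: "(K1 has_real_derivative
       ?c * (4 * ?s\<^sup>2 * ?c\<^sup>2 * ?S2 + (2 * ?c\<^sup>2 - 6 * ?s\<^sup>2) * ?S1 - ?S) + cos (\<beta> / 3) / 9) (at \<beta>)"
      unfolding K1_def[abs_def]
      by (rule DERIV_cong, (rule derivative_intros dS[OF that] numeral_neq_zero)+) (simp_all add: power2_eq_square algebra_simps)
    have "4 * ?s\<^sup>2 * ?c\<^sup>2 * ?S2 + (2 * ?c\<^sup>2 - 6 * ?s\<^sup>2) * ?S1 - ?S
                 = 4 * (?s\<^sup>2 * (1 - ?s\<^sup>2) * ?S2 + (1/2 - 2 * ?s\<^sup>2) * ?S1) - ?S"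
      unfolding cc by (simp add: algebra_simps)
    also have "\<dots> = - ?S / 9"
      unfolding trisection_series_ode[OF x[OF that]] by simp
    finally show ?thesis using d by (simp add: K_def algebra_simps diff_divide_distrib)
  qed
  \<comment> \<open>Uniqueness for the oscillator by its energy: with \<open>K' = K1\<close> and
    \<open>K1' = - K / 9\<close> this quadratic form is conserved. It is 0 at the origin, so both
    squares vanish.\<close>
  have "(\<lambda>\<beta>. (K1 \<beta>)\<^sup>2 + (K \<beta>)\<^sup>2 / 9) \<alpha> = (\<lambda>\<beta>. (K1 \<beta>)\<^sup>2 + (K \<beta>)\<^sup>2 / 9) 0"
  proof (rule DERIV_isconst3[where f = "\<lambda>\<beta>. (K1 \<beta>)\<^sup>2 + (K \<beta>)\<^sup>2 / 9" and a = "-pi/2" and b = "pi/2"])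
    fix \<beta> assume "\<beta> \<in> {- pi / 2<..<pi / 2}"
    then have b: "\<bar>\<beta>\<bar> < pi / 2" by auto
    show "((\<lambda>\<beta>. (K1 \<beta>)\<^sup>2 + (K \<beta>)\<^sup>2 / 9) has_real_derivative 0) (at \<beta>)"
      by (auto intro!: derivative_eq_intros dK[OF b] dK1[OF b])
  qed (use assms in auto)
  also have "\<dots> = 0" by (simp add: K_def K1_def trisection_series_0)
  finally have "(K \<alpha>)\<^sup>2 / 9 = 0" using zero_le_power2[of "K1 \<alpha>"] zero_le_power2[of "K \<alpha>"] by linarith
  then show ?thesis by (simp add: K_def)
qed

lemma has_integral_sin_even_power:
  "((\<lambda>x. (sin x ^ 2) ^ n) has_integral (pi / 2 * (pochhammer (1/2) n / fact n))) {0..pi/2}"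
proof (induction n)
  case 0
  show ?case using has_integral_const_real[of "1::real" 0 "pi/2"] by simp
next
  case (Suc n)
  \<comment> \<open>Wallis' reduction formula: the integrand is the derivative of
    \<open>- cos x * sin x ^ (2 * n + 1)\<close>, which is 0 at both ends.\<close>
  have "((\<lambda>x. (2 * real n + 2) * (sin x ^ 2) ^ Suc n - (2 * real n + 1) * (sin x ^ 2) ^ n) has_integral
          (- cos (pi/2) * sin (pi/2) ^ (2 * n + 1) - (- cos 0 * sin 0 ^ (2 * n + 1)))) {0..pi/2}"
  proof (rule fundamental_theorem_of_calculus)
    fix x assume "x \<in> {0..pi/2}"
    have cc: "(cos x)\<^sup>2 = 1 - (sin x)\<^sup>2" by (simp add: cos_squared_eq)
    have "((\<lambda>x. - cos x * sin x ^ (2 * n + 1)) has_real_derivative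
         sin x * sin x ^ (2 * n + 1) - (2 * real n + 1) * sin x ^ (2 * n) * (cos x)\<^sup>2) (at x)"
      by (rule derivative_eq_intros refl)+ (simp add: power2_eq_square algebra_simps)
    also have "sin x * sin x ^ (2 * n + 1) - (2 * real n + 1) * sin x ^ (2 * n) * (cos x)\<^sup>2
       = (2 * real n + 2) * (sin x ^ 2) ^ Suc n - (2 * real n + 1) * (sin x ^ 2) ^ n"
      unfolding cc power_mult[symmetric] by (simp add: algebra_simps power2_eq_square power_add)
    finally show "((\<lambda>x. - cos x * sin x ^ (2 * n + 1)) has_vector_derivative
        (2 * real n + 2) * (sin x ^ 2) ^ Suc n - (2 * real n + 1) * (sin x ^ 2) ^ n) (at x within {0..pi/2})"
      unfolding has_real_derivative_iff_has_vector_derivative[symmetric]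
      by (rule has_field_derivative_at_within)
  qed simp
  then have "((\<lambda>x. (2 * real n + 2) * (sin x ^ 2) ^ Suc n - (2 * real n + 1) * (sin x ^ 2) ^ n) has_integral 0) {0..pi/2}"
    by simp
  from has_integral_add[OF this has_integral_mult_right[OF Suc, of "2 * real n + 1"]]
  have "((\<lambda>x. (2 * real n + 2) * (sin x ^ 2) ^ Suc n) has_integral
           (2 * real n + 1) * (pi / 2 * (pochhammer (1/2) n / fact n))) {0..pi/2}"
    by simp
  from has_integral_mult_right[OF this, of "1 / (2 * real n + 2)"]
  have "((\<lambda>x. (sin x ^ 2) ^ Suc n) has_integral
           1 / (2 * real n + 2) * ((2 * real n + 1) * (pi / 2 * (pochhammer (1/2) n / fact n)))) {0..pi/2}"
    by (simp add: divide_simps) 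
  moreover have "1 / (2 * real n + 2) * ((2 * real n + 1) * (pi / 2 * (pochhammer (1/2) n / fact n)))
                  = pi / 2 * (pochhammer (1/2) (Suc n) / fact (Suc n))"
    by (simp add: pochhammer_Suc divide_simps add_ac)
  ultimately show ?case by simp
qed

lemma has_integral_trisection_series:
  fixes k :: real
  assumes "0 \<le> k" "k < 1"
  shows "((\<lambda>\<theta>. trisection_series ((k * sin \<theta>)\<^sup>2)) has_integral pi / 2 * hyp2F1 (1/3) (2/3) 1 (k\<^sup>2)) {0..pi/2}"
proof -
  have k2: "0 \<le> k\<^sup>2" "k\<^sup>2 < 1" using assms by (auto simp: power_less_one_iff abs_square_less_1)
  let ?f = "\<lambda>N \<theta>. \<Sum>n<N. trisection_coeff n * (k * sin \<theta>)\<^sup>2 ^ n"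
  have unif: "uniform_limit {0..pi/2} ?f (\<lambda>\<theta>. \<Sum>n. trisection_coeff n * (k * sin \<theta>)\<^sup>2 ^ n) sequentially"
  proof (rule Weierstrass_m_test)
    fix n \<theta>
    have "(k * sin \<theta>)\<^sup>2 \<le> k\<^sup>2"
      by (simp add: power_mult_distrib mult_left_le abs_square_le_1)
    then have "((k * sin \<theta>)\<^sup>2) ^ n \<le> (k\<^sup>2) ^ n" by (rule power_mono) simp
    then show "norm (trisection_coeff n * (k * sin \<theta>)\<^sup>2 ^ n) \<le> (k\<^sup>2) ^ n"
      using trisection_coeff_bounds[of n] mult_mono[of "trisection_coeff n" 1 "((k * sin \<theta>)\<^sup>2) ^ n" "(k\<^sup>2) ^ n"]
      by (simp add: abs_mult)
  next
    show "summable (\<lambda>n. (k\<^sup>2) ^ n)" using k2 by (intro summable_geometric) auto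
  qed
  have summand: "((\<lambda>\<theta>. trisection_coeff n * (k * sin \<theta>)\<^sup>2 ^ n) has_integral
      (pi / 2 * (pochhammer (1/3) n * pochhammer (2/3) n / (pochhammer 1 n * fact n) * (k\<^sup>2) ^ n))) {0..pi/2}" for n
  proof -
    have nz: "pochhammer (1/2 :: real) n \<noteq> 0"
      by (metis pochhammer_pos less_irrefl zero_less_divide_1_iff zero_less_numeral)
    have "trisection_coeff n * (k\<^sup>2) ^ n * (pi / 2 * (pochhammer (1/2) n / fact n))
       = (pi / 2 * (pochhammer (1/3) n * pochhammer (2/3) n / (pochhammer 1 n * fact n) * (k\<^sup>2) ^ n))"
      using nz by (simp add: trisection_coeff_def pochhammer_fact[symmetric] mult_ac)
    then show ?thesis
      using has_integral_mult_right[OF has_integral_sin_even_power[of n], of "trisection_coeff n * (k\<^sup>2) ^ n"]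
      by (simp add: power_mult_distrib mult.assoc)
  qed
  have int: "(?f N has_integral (\<Sum>n<N. pi / 2 * (pochhammer (1/3) n * pochhammer (2/3) n / (pochhammer 1 n * fact n) * (k\<^sup>2) ^ n))) {0..pi/2}" for N
    by (intro has_integral_sum summand) auto
  have cont: "continuous_on {0..pi/2} (?f N)" for N
    by (intro continuous_intros)
  obtain I J where I: "\<And>N. (?f N has_integral I N) {0..pi/2}"
    and J: "((\<lambda>\<theta>. \<Sum>n. trisection_coeff n * (k * sin \<theta>)\<^sup>2 ^ n) has_integral J) {0..pi/2}"
    and lim: "I \<longlonglongrightarrow> J"
    using uniform_limit_integral[OF unif cont] by auto
  have "I = (\<lambda>N. \<Sum>n<N. pi / 2 * (pochhammer (1/3) n * pochhammer (2/3) n / (pochhammer 1 n * fact n) * (k\<^sup>2) ^ n))"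
    using has_integral_unique[OF I int] by auto
  with lim have "(\<lambda>n. pi / 2 * (pochhammer (1/3) n * pochhammer (2/3) n / (pochhammer 1 n * fact n) * (k\<^sup>2) ^ n)) sums J"
    by (simp add: sums_def)
  then have "(\<lambda>n. 2 / pi * (pi / 2 * (pochhammer (1/3) n * pochhammer (2/3) n / (pochhammer 1 n * fact n) * (k\<^sup>2) ^ n))) sums (2 / pi * J)"
    by (rule sums_mult)
  then have "hyp2F1 (1/3) (2/3) 1 (k\<^sup>2) = 2 / pi * J"
    unfolding hyp2F1_def by (simp add: sums_iff mult.assoc)
  then have "J = pi / 2 * hyp2F1 (1/3) (2/3) 1 (k\<^sup>2)" by simp
  with J show ?thesis unfolding trisection_series_def by simp
qed

section \<open>Motion from infinity to a turning point\<close>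

text \<open>With \<open>q = 1 / sqrt v\<close> and \<open>sin \<theta> = q (1 - t q\<^sup>2) / 2\<close> the differential equation becomes
  \<open>\<theta>' = c (1 - 3 t q\<^sup>2)\<close>, and \<open>1 / (1 - 3 t q\<^sup>2)\<close> is the trisection series at
  \<open>(k sin \<theta>)\<^sup>2\<close> because \<open>q\<close> is \<open>6 / k\<close> times the sine of a third of \<open>arcsin (k sin \<theta>)\<close>.\<close>

lemma time_to_turning_point:
  fixes v :: "real \<Rightarrow> real" and k c T :: real
  assumes k: "0 < k" "k < 1" and c: "0 < c" and T: "0 < T"
    and cont: "continuous_on {0<..T} v"
    and deriv: "\<And>u. 0 < u \<Longrightarrow> u < T \<Longrightarrow>
          (v has_real_derivative - 2 * c * sqrt (4 * v u ^ 3 - (v u - k\<^sup>2 / 27)\<^sup>2)) (at u)"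
    and pos: "\<And>u. 0 < u \<Longrightarrow> u < T \<Longrightarrow> (v u - k\<^sup>2 / 27)\<^sup>2 < 4 * v u ^ 3"
    and turn: "4 * v T ^ 3 = (v T - k\<^sup>2 / 27)\<^sup>2"
    and lim: "filterlim v at_top (at_right 0)"
  shows "c * T = pi / 2 * hyp2F1 (1/3) (2/3) 1 (k\<^sup>2)"
proof -
  define t where "t = k\<^sup>2 / 27"
  have t: "t > 0" using k by (simp add: t_def)
  \<comment> \<open>The value 0 at the origin is the limit of \<open>1 / sqrt v\<close> there, so
    \<open>q\<close> is continuous on the closed interval although \<open>v\<close> is
    unbounded.\<close>
  define q where "q u = (if u = 0 then 0 else 1 / sqrt (v u))" for u
  define s where "s u = q u * (1 - t * (q u)\<^sup>2) / 2" for u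
  have vpos: "v u > 0" if "0 < u" "u \<le> T" for u
  proof (cases "u = T")
    case True
    have "v T \<noteq> 0" using turn t by (auto simp: t_def)
    moreover have "0 \<le> 4 * v T ^ 3" unfolding turn by simp
    then have "v T \<ge> 0" by (simp add: zero_le_power_eq)
    ultimately show ?thesis using True by simp
  next
    case False
    then have "0 < 4 * v u ^ 3" using pos[of u] that by (smt (verit) zero_le_power2)
    then show ?thesis by (simp add: zero_less_power_eq)
  qed
  have qv: "q u > 0" "(q u)\<^sup>2 * v u = 1" if "0 < u" "u \<le> T" for u
    using vpos[OF that] that by (auto simp: q_def power_divide)
  have key: "4 * v u ^ 3 - (v u - t)\<^sup>2 = 4 * v u ^ 3 * (1 - (s u)\<^sup>2)" if "0 < u" "u \<le> T" for u
  proof -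
    have w: "(q u)\<^sup>2 = 1 / v u" using qv[OF that] vpos[OF that] by (simp add: field_simps)
    have "(s u)\<^sup>2 = (q u)\<^sup>2 * (1 - t * (q u)\<^sup>2)\<^sup>2 / 4"
      by (simp add: s_def power_mult_distrib power_divide)
    also have "\<dots> = 1 / v u * (1 - t / v u)\<^sup>2 / 4" unfolding w by simp
    finally show ?thesis using vpos[OF that]
      by (simp add: field_simps power2_eq_square power3_eq_cube)
  qed
  have s_lt: "(s u)\<^sup>2 < 1" if "0 < u" "u < T" for u
  proof -
    have "0 < 4 * v u ^ 3 * (1 - (s u)\<^sup>2)"
      using key[of u] pos[of u] that by (simp add: t_def)
    then show ?thesis using vpos[of u] that by (simp add: zero_less_mult_iff)
  qed
  have "4 * v T ^ 3 * (1 - (s T)\<^sup>2) = 0"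
    using key[OF T order_refl] turn[folded t_def] by linarith
  then have sT2: "(s T)\<^sup>2 = 1" using vpos[OF T order_refl] by simp
  have s_le: "\<bar>s u\<bar> \<le> 1" if "0 < u" "u \<le> T" for u
    using s_lt[of u] sT2 that abs_square_le_1[of "s u"] by (cases "u = T") auto
  have contq: "continuous_on {0..T} q"
    unfolding continuous_on_eq_continuous_within
  proof
    fix u assume u: "u \<in> {0..T}"
    show "continuous (at u within {0..T}) q"
    proof (cases "u = 0")
      case True
      have "((\<lambda>u. inverse (sqrt (v u))) \<longlongrightarrow> 0) (at_right 0)"
        by (intro tendsto_inverse_0_at_top filterlim_compose[OF sqrt_at_top lim])
      then have "(q \<longlongrightarrow> 0) (at_right 0)"
        by (rule Lim_transform_eventually)
           (auto simp: eventually_at_filter q_def divide_inverse)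
      then show ?thesis using True T
        by (simp add: continuous_within at_within_Icc_at_right q_def)
    next
      case False
      have "continuous_on {0<..T} (\<lambda>u. 1 / sqrt (v u))"
        by (intro continuous_intros cont) (use vpos in force)
      then have "continuous_on {0<..T} q"
        by (rule continuous_on_eq) (auto simp: q_def)
      then have "continuous (at u within {0<..T}) q"
        using u False by (auto simp: continuous_on_eq_continuous_within)
      moreover have "at u within {0..T} = at u within {0<..T}"
        by (rule at_within_nhd[of _ "{0<..}"]) (use u False in auto)
      ultimately show ?thesis by (simp add: continuous_within)
    qed
  qed
  \<comment> \<open>As a function of \<open>q > 0\<close>, the quantity \<open>s\<close> is largest
    at \<open>q = 3 / k\<close>, with value \<open>1 / k > 1\<close>. Since \<open>s\<close> never
    exceeds 1 and \<open>q\<close> starts at 0, continuity keeps \<open>q\<close> below this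
    point.\<close>
  have q_lt: "q u < 3 / k" if "0 < u" "u \<le> T" for u
  proof (rule ccontr)
    assume "\<not> q u < 3 / k"
    then have "\<exists>x\<ge>0. x \<le> u \<and> q x = 3 / k"
      using k that by (intro IVT' continuous_on_subset[OF contq]) (auto simp: q_def)
    then obtain x where x: "0 \<le> x" "x \<le> u" "q x = 3 / k" by blast
    then have "x \<noteq> 0" using k by (auto simp: q_def)
    have "s x = 1 / k"
      unfolding s_def x(3) t_def using k by (simp add: field_simps power2_eq_square)
    then have "\<bar>1 / k\<bar> \<le> 1" using s_le[of x] x \<open>x \<noteq> 0\<close> that by simp
    then show False using k by simp
  qed
  have tq: "3 * t * (q u)\<^sup>2 < 1" if "0 < u" "u \<le> T" for u
  proof -
    have "(q u)\<^sup>2 < (3 / k)\<^sup>2" using q_lt[OF that] qv[OF that] by (intro power_strict_mono) auto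
    then show ?thesis using k by (simp add: t_def field_simps)
  qed
  have s_pos: "s u > 0" if "0 < u" "u \<le> T" for u
    unfolding s_def using tq[OF that] qv[OF that] by (intro divide_pos_pos mult_pos_pos) auto
  have sT: "s T = 1" using sT2 s_pos[of T] T by (simp add: power2_eq_1_iff)
  define \<theta> where "\<theta> u = arcsin (s u)" for u
  define f where "f x = trisection_series ((k * sin x)\<^sup>2)" for x
  define U where "U x = integral {0..x} f" for x
  have f: "f (\<theta> u) * (1 - 3 * t * (q u)\<^sup>2) = 1" if "0 < u" "u \<le> T" for u
  proof -
    define \<phi> where "\<phi> = arcsin (k * q u / 6)"
    \<comment> \<open>The bound \<open>q < 3 / k\<close> places \<open>3 * \<phi>\<close> below a
      right angle, the range in which \<open>trisection_series_sin\<close> applies and the branch of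
      the arcsine is the right one.\<close>
    have b: "0 < k * q u / 6" "k * q u / 6 < 1/2"
      using qv[OF that] q_lt[OF that] k by (auto simp: field_simps)
    have sp: "sin \<phi> = k * q u / 6" unfolding \<phi>_def using b by (intro sin_arcsin) auto
    have "\<phi> < arcsin (1/2)" unfolding \<phi>_def using b by (subst arcsin_less_mono) auto
    also have "arcsin (1/2) = pi / 6"
      by (rule arcsin_unique) (auto simp: sin_30)
    finally have p: "\<phi> < pi / 6" .
    have "arcsin 0 < \<phi>" unfolding \<phi>_def using b by (subst arcsin_less_mono) auto
    then have p0: "\<phi> > 0" by simp
    have cp: "cos \<phi> > 0" using p p0 by (intro cos_gt_zero_pi) auto
    have c2: "(cos \<phi>)\<^sup>2 = 1 - (sin \<phi>)\<^sup>2" by (simp add: cos_squared_eq)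
    have "sin (3 * \<phi>) = sin (2 * \<phi>) * cos \<phi> + cos (2 * \<phi>) * sin \<phi>"
      using sin_add[of "2 * \<phi>" \<phi>] by simp
    also have "\<dots> = 2 * sin \<phi> * (cos \<phi>)\<^sup>2 + ((cos \<phi>)\<^sup>2 - (sin \<phi>)\<^sup>2) * sin \<phi>"
      unfolding sin_double cos_double by (simp add: power2_eq_square)
    finally have s3: "sin (3 * \<phi>) = 3 * sin \<phi> - 4 * sin \<phi> ^ 3"
      unfolding c2 by (simp add: power2_eq_square power3_eq_cube algebra_simps)
    have "cos (3 * \<phi>) = cos (2 * \<phi>) * cos \<phi> - sin (2 * \<phi>) * sin \<phi>"
      using cos_add[of "2 * \<phi>" \<phi>] by simp
    also have "\<dots> = cos \<phi> * ((cos \<phi>)\<^sup>2 - 3 * (sin \<phi>)\<^sup>2)"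
      unfolding sin_double cos_double by (simp add: power2_eq_square algebra_simps)
    finally have c3: "cos (3 * \<phi>) = cos \<phi> * (1 - 4 * (sin \<phi>)\<^sup>2)"
      unfolding c2 by simp
    have "k * s u = sin (3 * \<phi>)"
      unfolding s3 sp by (simp add: s_def t_def power2_eq_square power3_eq_cube field_simps)
    moreover have "sin (\<theta> u) = s u" unfolding \<theta>_def using s_le[OF that] by (intro sin_arcsin) auto
    ultimately have "f (\<theta> u) * cos (3 * \<phi>) = cos \<phi>"
      unfolding f_def using trisection_series_sin[of "3 * \<phi>"] p p0 by simp
    then have "(f (\<theta> u) * (1 - 4 * (sin \<phi>)\<^sup>2)) * cos \<phi> = 1 * cos \<phi>"
      unfolding c3 by (simp add: mult_ac)
    then have "f (\<theta> u) * (1 - 4 * (sin \<phi>)\<^sup>2) = 1"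
      unfolding mult_cancel_right using cp by simp
    then show ?thesis unfolding sp by (simp add: t_def power_mult_distrib power_divide)
  qed
  have contf: "continuous_on {0..pi/2} f"
    unfolding f_def
  proof (intro continuous_at_imp_continuous_on ballI)
    fix x :: real
    have "(k * sin x)\<^sup>2 \<le> k\<^sup>2"
      by (simp add: power_mult_distrib mult_left_le abs_square_le_1)
    moreover have "k\<^sup>2 < 1" using k by (simp add: abs_square_less_1)
    ultimately have "\<bar>(k * sin x)\<^sup>2\<bar> < 1" unfolding abs_power2 by linarith
    then have "isCont trisection_series ((k * sin x)\<^sup>2)"
      using trisection_series_deriv(1) DERIV_isCont by blast
    then show "isCont (\<lambda>x. trisection_series ((k * sin x)\<^sup>2)) x"
      by (rule isCont_o2[rotated]) (intro continuous_intros)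
  qed
  have th: "0 < \<theta> u" "\<theta> u < pi / 2" if "0 < u" "u < T" for u
  proof -
    have "\<bar>s u\<bar> < 1" using s_lt[OF that] by (simp add: abs_square_less_1)
    then show "\<theta> u < pi / 2" unfolding \<theta>_def by (intro arcsin_lt_bounded[THEN conjunct2]) auto
    have "arcsin 0 < \<theta> u" unfolding \<theta>_def using s_pos[of u] s_le[of u] that by (subst arcsin_less_mono) auto
    then show "0 < \<theta> u" by simp
  qed
  have dq: "(q has_real_derivative 2 * c * sqrt (1 - (s u)\<^sup>2)) (at u)" if u: "0 < u" "u < T" for u
  proof -
    have vp: "v u > 0" using vpos[of u] u by simp
    let ?r = "sqrt (v u)"
    have rr: "?r > 0" "v u = ?r\<^sup>2" using vp by auto
    have "(2 * r ^ 3)\<^sup>2 = 4 * (r\<^sup>2) ^ 3" for r :: real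
      by (simp add: power2_eq_square power3_eq_cube)
    from this[of ?r] have "sqrt (4 * v u ^ 3 - (v u - t)\<^sup>2) = sqrt ((2 * ?r ^ 3)\<^sup>2 * (1 - (s u)\<^sup>2))"
      unfolding key[OF u(1) less_imp_le[OF u(2)]] by (simp only: rr(2)[symmetric])
    also have "\<dots> = 2 * ?r ^ 3 * sqrt (1 - (s u)\<^sup>2)"
      unfolding real_sqrt_mult real_sqrt_abs using rr(1) by simp
    finally have e: "sqrt (4 * v u ^ 3 - (v u - t)\<^sup>2) = 2 * ?r ^ 3 * sqrt (1 - (s u)\<^sup>2)" .
    have "((\<lambda>u. inverse (sqrt (v u))) has_real_derivative
        - (inverse ?r * (inverse ?r / 2 * (- 2 * c * sqrt (4 * v u ^ 3 - (v u - t)\<^sup>2))) * inverse ?r)) (at u)"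
      by (rule DERIV_inverse' DERIV_chain2[OF DERIV_real_sqrt] deriv[OF u, folded t_def] vp)+
         (use vp in simp)
    also have "- (inverse ?r * (inverse ?r / 2 * (- 2 * c * sqrt (4 * v u ^ 3 - (v u - t)\<^sup>2))) * inverse ?r)
                = 2 * c * sqrt (1 - (s u)\<^sup>2)"
      unfolding e using rr(1) by (simp add: field_simps power3_eq_cube)
    finally show ?thesis
      by (rule has_field_derivative_transform_within_open[where S = "{0<..}"])
         (use u in \<open>auto simp: q_def divide_inverse\<close>)
  qed
  have dth: "(\<theta> has_real_derivative c * (1 - 3 * t * (q u)\<^sup>2)) (at u)" if u: "0 < u" "u < T" for u
  proof -
    have s1: "\<bar>s u\<bar> < 1" using s_lt[OF that] by (simp add: abs_square_less_1)
    define \<rho> where "\<rho> = sqrt (1 - (s u)\<^sup>2)"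
    have r: "\<rho> > 0" using s_lt[OF that] by (simp add: \<rho>_def)
    have "(s has_real_derivative c * \<rho> * (1 - 3 * t * (q u)\<^sup>2)) (at u)"
      unfolding s_def[abs_def]
      by (rule DERIV_cong, (rule derivative_intros dq[OF that, folded \<rho>_def] numeral_neq_zero)+)
         (simp add: power2_eq_square field_simps)
    from DERIV_chain2[OF DERIV_arcsin this] s1
    have "(\<theta> has_real_derivative inverse \<rho> * (c * \<rho> * (1 - 3 * t * (q u)\<^sup>2))) (at u)"
      unfolding \<theta>_def[abs_def] \<rho>_def by simp
    moreover have "inverse \<rho> * (c * \<rho> * (1 - 3 * t * (q u)\<^sup>2)) = c * (1 - 3 * t * (q u)\<^sup>2)"
      using r by (simp add: field_simps)
    ultimately show ?thesis by (simp only:)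
  qed
  have conts: "continuous_on {0..T} s" unfolding s_def by (intro continuous_intros contq) auto
  have s01: "0 \<le> s u \<and> s u \<le> 1" if "u \<in> {0..T}" for u
  proof (cases "u = 0")
    case False
    then show ?thesis using that s_pos[of u] s_le[of u] by force
  qed (simp add: s_def q_def)
  have contth: "continuous_on {0..T} \<theta>"
    unfolding \<theta>_def by (intro continuous_intros conts) (use s01 in force)
  \<comment> \<open>Only continuity is used at the two ends: at 0 the position is infinite, and at
    \<open>T\<close> the arcsine is evaluated at 1, where it has no derivative.\<close>
  have "U (\<theta> T) - c * T = U (\<theta> 0) - c * 0"
  proof (rule DERIV_isconst_end[where f = "\<lambda>u. U (\<theta> u) - c * u"])
    have contU: "continuous_on {0..pi/2} U"
      unfolding U_def by (intro indefinite_integral_continuous_1 integrable_continuous_real contf)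
    have "\<theta> ` {0..T} \<subseteq> {0..pi/2}"
    proof safe
      fix u assume "u \<in> {0..T}"
      from s01[OF this] show "\<theta> u \<in> {0..pi/2}"
        unfolding \<theta>_def using arcsin_ubound[of "s u"] arcsin_le_mono[of 0 "s u"] by auto
    qed
    then show "continuous_on {0..T} (\<lambda>u. U (\<theta> u) - c * u)"
      by (intro continuous_intros continuous_on_compose2[OF contU contth]) auto
    fix u assume u: "0 < u" "u < T"
    have "(U has_real_derivative f (\<theta> u)) (at (\<theta> u) within {0..pi/2})"
      unfolding U_def[abs_def] using th[OF u] by (intro integral_has_real_derivative contf) auto
    then have "(U has_real_derivative f (\<theta> u)) (at (\<theta> u))"
      using th[OF u] by (simp add: at_within_Icc_at)
    from DERIV_chain2[OF this dth[OF u]]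
    have "((\<lambda>u. U (\<theta> u)) has_real_derivative c * (f (\<theta> u) * (1 - 3 * t * (q u)\<^sup>2))) (at u)"
      by (simp add: mult_ac)
    then have "((\<lambda>u. U (\<theta> u)) has_real_derivative c) (at u)" using f[of u] u by simp
    then show "((\<lambda>u. U (\<theta> u) - c * u) has_real_derivative 0) (at u)"
      by (auto intro!: derivative_eq_intros)
  qed (rule T)
  moreover have "U (\<theta> 0) = 0" by (simp add: \<theta>_def s_def q_def U_def)
  moreover have "U (\<theta> T) = pi / 2 * hyp2F1 (1/3) (2/3) 1 (k\<^sup>2)"
    unfolding U_def \<theta>_def sT arcsin_1 f_def
    using has_integral_trisection_series[of k] k by (intro integral_unique) auto
  ultimately show ?thesis by simp
qed

text \<open>The substitution \<open>v = (x + t / x + t\<^sup>2 / x\<^sup>2) / 3 + 1 / 9\<close> is the 3-isogeny of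
  \<open>y\<^sup>2 = 4 x\<^sup>3 + (x + t)\<^sup>2\<close> with kernel generated by \<open>(0, t)\<close>. It takes \<open>(0, T]\<close> three times
  through the motion of the previous lemma, with \<open>t\<close> replaced by \<open>1 / 27 - t\<close>.\<close>

lemma time_to_turning_point_isogeny:
  fixes x :: "real \<Rightarrow> real" and k l T :: real
  assumes k: "0 < k" and l: "0 < l" and kl: "k\<^sup>2 + l\<^sup>2 = 1" and T: "0 < T"
    and cont: "continuous_on {0<..T} x"
    and deriv: "\<And>u. 0 < u \<Longrightarrow> u < T \<Longrightarrow>
          (x has_real_derivative - 2 * sqrt (4 * x u ^ 3 + (x u + k\<^sup>2 / 27)\<^sup>2)) (at u)"
    and pos: "\<And>u. 0 < u \<Longrightarrow> u < T \<Longrightarrow> 0 < 4 * x u ^ 3 + (x u + k\<^sup>2 / 27)\<^sup>2"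
    and turn: "4 * x T ^ 3 + (x T + k\<^sup>2 / 27)\<^sup>2 = 0"
    and lim: "filterlim x at_top (at_right 0)"
  shows "T = sqrt 3 * (pi / 2 * hyp2F1 (1/3) (2/3) 1 (l\<^sup>2))"
proof -
  define t where "t = k\<^sup>2 / 27"
  define W where "W = pi / 2 * hyp2F1 (1/3) (2/3) 1 (l\<^sup>2)"
  define V where "V z = (z + t / z + t\<^sup>2 / z\<^sup>2) / 3 + 1 / 9" for z
  \<comment> \<open>Three times the derivative of \<open>V\<close>; its sign tells whether the image
    motion falls or rises.\<close>
  define D where "D z = 1 - t / z\<^sup>2 - 2 * t\<^sup>2 / z ^ 3" for z
  define y where "y u = sqrt (4 * x u ^ 3 + (x u + t)\<^sup>2)" for u
  have l2: "l\<^sup>2 / 27 = 1 / 27 - t" using kl by (simp add: t_def)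
  have l1: "l < 1"
  proof -
    have "0 < k\<^sup>2" using k by simp
    then have "l\<^sup>2 < 1" using kl by linarith
    then show ?thesis using l abs_square_less_1[of l] by simp
  qed
  have t: "0 < t" "t < 1 / 27"
  proof -
    show "0 < t" using k by (simp add: t_def)
    have "0 < l\<^sup>2 / 27" using l by simp
    then show "t < 1 / 27" using l2 by linarith
  qed
  have curve: "27 * (4 * V z ^ 3 - (V z - (1 / 27 - t))\<^sup>2) = (4 * z ^ 3 + (z + t)\<^sup>2) * (D z)\<^sup>2"
    if "z \<noteq> 0" for z
  proof -
    \<comment> \<open>In terms of \<open>z\<close> and \<open>a\<close> all denominators disappear
      and the identity is one between polynomials.\<close>
    define a where "a = t / z"
    have ta: "t = a * z" using that by (simp add: a_def)
    have V: "V z = (z + a + a\<^sup>2) / 3 + 1 / 9"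
      using that by (simp add: V_def ta power_mult_distrib)
    have D: "D z * z = z - a - 2 * a\<^sup>2"
      using that by (simp add: D_def ta field_simps power2_eq_square power3_eq_cube)
    have "(4 * z ^ 3 + (z + t)\<^sup>2) * (D z)\<^sup>2 = (4 * z + (1 + a)\<^sup>2) * (D z * z)\<^sup>2"
      by (simp add: ta power2_eq_square power3_eq_cube algebra_simps)
    also have "\<dots> = 27 * (4 * V z ^ 3 - (V z - (1 / 27 - t))\<^sup>2)"
      unfolding V D ta by (simp add: power2_eq_square power3_eq_cube field_simps)
    finally show ?thesis ..
  qed
  have Dz: "D z = (z ^ 3 - t * z - 2 * t\<^sup>2) / z ^ 3" if "z \<noteq> 0" for z
    using that unfolding D_def by (simp add: field_simps power2_eq_square power3_eq_cube)
  have V0: "filterlim V at_top (at 0)"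
  proof -
    have "filterlim V at_top (at_right 0)" "filterlim V at_top (at_left 0)"
      unfolding V_def[abs_def] using t by real_asymp+
    then show ?thesis by (simp add: filterlim_at_split)
  qed
  have Vinf: "filterlim V at_top at_top"
    unfolding V_def[abs_def] using t by real_asymp
  have decr: "x u' < x u" if "0 < u" "u < u'" "u' \<le> T" for u u'
  proof -
    have "\<exists>l z. u < z \<and> z < u' \<and> DERIV x z :> l \<and> x u' - x u = (u' - u) * l"
    proof (rule MVT)
      show "continuous_on {u..u'} x" by (rule continuous_on_subset[OF cont]) (use that in auto)
      fix z assume "u < z" "z < u'"
      then have "0 < z" "z < T" using that by auto
      from deriv[OF this] show "x differentiable (at z)"
        unfolding real_differentiable_def by blast
    qed (rule that)
    then obtain m z where z: "u < z" "z < u'" "DERIV x z :> m" "x u' - x u = (u' - u) * m" by blast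
    then have "m = - 2 * sqrt (4 * x z ^ 3 + (x z + k\<^sup>2 / 27)\<^sup>2)"
      using deriv[of z] that by (intro DERIV_unique[OF z(3)]) auto
    then have "m < 0" using pos[of z] z that by simp
    then have "(u' - u) * m < 0" using that by (simp add: mult_pos_neg)
    then show ?thesis using z by linarith
  qed
  have big: "\<exists>u. 0 < u \<and> u < a \<and> B \<le> x u" if "0 < a" for a B
  proof -
    have "eventually (\<lambda>u. B \<le> x u) (at_right 0)" using lim by (simp add: filterlim_at_top)
    moreover have "eventually (\<lambda>u. u < a) (at_right 0)"
      using eventually_at_right_real[OF that] by eventually_elim auto
    moreover have "eventually (\<lambda>u::real. 0 < u) (at_right 0)" by (simp add: eventually_at_right_less)
    ultimately have "eventually (\<lambda>u. 0 < u \<and> u < a \<and> B \<le> x u) (at_right 0)"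
      by eventually_elim auto
    then show ?thesis using eventually_happens'[OF trivial_limit_at_right_real] by blast
  qed
  have hit: "\<exists>u. 0 < u \<and> u < a \<and> x u = B" if "0 < a" "a \<le> T" "x a < B" for a B
  proof -
    obtain b where b: "0 < b" "b < a" "B \<le> x b" using big[of a B] \<open>0 < a\<close> by blast
    have "\<exists>u\<ge>b. u \<le> a \<and> x u = B"
      using b that by (intro IVT2' continuous_on_subset[OF cont]) auto
    then obtain u where "b \<le> u" "u \<le> a" "x u = B" by blast
    then show ?thesis using b that by (intro exI[of _ u]) (auto simp: less_le)
  qed
  have xT: "x T < 0"
  proof (rule ccontr)
    assume "\<not> x T < 0"
    then have "0 \<le> 4 * x T ^ 3" "0 < x T + k\<^sup>2 / 27" using t by (auto simp: t_def intro: add_nonneg_pos)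
    then have "0 \<le> 4 * x T ^ 3" "0 < (x T + k\<^sup>2 / 27)\<^sup>2" by auto
    then show False using turn by linarith
  qed
  obtain u0 where u0: "0 < u0" "u0 < T" "x u0 = 0" using hit[of T 0] T xT by auto
  \<comment> \<open>The positive zero of \<open>D\<close>, where \<open>V\<close> has its minimum
    over the positive axis. It maps to a turning point of the image motion although the original
    motion passes through it.\<close>
  have "\<exists>z\<ge>0. z \<le> 1 \<and> z ^ 3 - t * z - 2 * t\<^sup>2 = 0"
  proof (rule IVT')
    have "t * t \<le> 1 * t" using t by (intro mult_right_mono) auto
    then show "0 \<le> 1 ^ 3 - t * 1 - 2 * t\<^sup>2"
      unfolding power2_eq_square power_one mult_1_right using t by linarith
  qed (auto intro!: continuous_intros)
  then obtain \<xi> where xi: "0 \<le> \<xi>" "\<xi> ^ 3 - t * \<xi> - 2 * t\<^sup>2 = 0" by blast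
  have "\<xi> \<noteq> 0" using xi t by auto
  then have xi0: "0 < \<xi>" using xi by simp
  have Dxi: "D \<xi> = 0" using Dz[of \<xi>] xi \<open>\<xi> \<noteq> 0\<close> by simp
  have Dmono: "D z < D z'" if "0 < z" "z < z'" for z z'
  proof -
    have "t / z'\<^sup>2 < t / z\<^sup>2" using that t by (intro divide_strict_left_mono power_strict_mono mult_pos_pos) auto
    moreover have "2 * t\<^sup>2 / z' ^ 3 < 2 * t\<^sup>2 / z ^ 3" using that t by (intro divide_strict_left_mono power_strict_mono mult_pos_pos) auto
    ultimately show ?thesis unfolding D_def by linarith
  qed
  obtain u1 where u1: "0 < u1" "u1 < u0" "x u1 = \<xi>" using hit[of u0 \<xi>] u0 xi0 by auto
  \<comment> \<open>At \<open>- t\<close> the radicand equals \<open>- 4 * t ^ 3\<close>, which is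
    negative, so the motion cannot get there.\<close>
  have xneg: "- t < x u" if "u0 < u" "u \<le> T" for u
  proof (rule ccontr)
    assume a: "\<not> - t < x u"
    then have "\<exists>w\<ge>u0. w \<le> u \<and> x w = - t"
      using u0 that t by (intro IVT2' continuous_on_subset[OF cont]) auto
    then obtain w where w: "u0 \<le> w" "w \<le> u" "x w = - t" by blast
    have "0 \<le> 4 * x w ^ 3 + (x w + t)\<^sup>2"
      using pos[of w] turn u0 w that by (cases "w = T") (auto simp: t_def less_imp_le)
    then show False using t by (simp add: w)
  qed
  \<comment> \<open>In the quotient \<open>Dz\<close> both numerator and denominator are negative
    here. So \<open>V\<close> falls once more from infinity while \<open>x\<close> falls from 0 to
    its turning point.\<close>
  have Dneg: "0 < D z" if "- t < z" "z < 0" for z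
  proof -
    have "t * (- z) < t * t" using that t by (intro mult_strict_left_mono) auto
    moreover have "z ^ 3 < 0" using that by (simp add: power_less_zero_eq)
    moreover have "0 \<le> t * t" by simp
    ultimately have "z ^ 3 - t * z - 2 * t\<^sup>2 < 0" unfolding power2_eq_square by linarith
    then show ?thesis using \<open>z ^ 3 < 0\<close> that by (simp add: Dz divide_neg_neg)
  qed
  have dV: "((\<lambda>u. V (x u)) has_real_derivative - (2 / 3) * D (x u) * y u) (at u)"
    if u: "0 < u" "u < T" "x u \<noteq> 0" for u
  proof -
    have "(V has_real_derivative D (x u) / 3) (at (x u))"
      unfolding V_def[abs_def] D_def using u(3)
      by (auto intro!: derivative_eq_intros simp: field_simps power2_eq_square power3_eq_cube)
    from DERIV_chain2[OF this deriv[OF u(1,2)]] show ?thesis by (simp add: y_def t_def mult_ac)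
  qed
  \<comment> \<open>The factor 27 in \<open>curve\<close> has root \<open>3 * sqrt 3\<close>; this
    is why the image motion runs with speed constant \<open>c = sqrt 3\<close>.\<close>
  have rad: "2 * sqrt 3 * sqrt (4 * V (x u) ^ 3 - (V (x u) - l\<^sup>2 / 27)\<^sup>2) = 2 / 3 * \<bar>D (x u)\<bar> * y u"
    if u: "x u \<noteq> 0" for u
  proof -
    have "4 * V (x u) ^ 3 - (V (x u) - l\<^sup>2 / 27)\<^sup>2 = (4 * x u ^ 3 + (x u + t)\<^sup>2) * (D (x u))\<^sup>2 / (3\<^sup>2 * 3)"
      using curve[OF u] unfolding l2 by simp
    then have "sqrt (4 * V (x u) ^ 3 - (V (x u) - l\<^sup>2 / 27)\<^sup>2) = y u * \<bar>D (x u)\<bar> / (3 * sqrt 3)"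
      by (simp only: real_sqrt_divide real_sqrt_mult y_def real_sqrt_abs abs_numeral)
    then show ?thesis by simp
  qed
  have radpos: "(V (x u) - l\<^sup>2 / 27)\<^sup>2 < 4 * V (x u) ^ 3"
    if u: "0 < u" "u < T" "x u \<noteq> 0" "D (x u) \<noteq> 0" for u
  proof -
    have "0 < 27 * (4 * V (x u) ^ 3 - (V (x u) - (1 / 27 - t))\<^sup>2)"
      unfolding curve[OF u(3)] using pos[OF u(1,2)] u(4) by (simp add: t_def)
    then show ?thesis unfolding l2 by simp
  qed
  have radzero: "4 * V (x u) ^ 3 = (V (x u) - l\<^sup>2 / 27)\<^sup>2"
    if u: "x u \<noteq> 0" "4 * x u ^ 3 + (x u + t)\<^sup>2 = 0 \<or> D (x u) = 0" for u
  proof -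
    have "27 * (4 * V (x u) ^ 3 - (V (x u) - (1 / 27 - t))\<^sup>2) = 0"
      unfolding curve[OF u(1)] using u(2) by auto
    then show ?thesis unfolding l2 by simp
  qed
  have contV: "continuous_on A (\<lambda>u. V (g u))" if "continuous_on A g" "\<And>u. u \<in> A \<Longrightarrow> g u \<noteq> 0" for A g
    unfolding V_def using that by (intro continuous_intros) auto
  have x0: "isCont x u0" using DERIV_isCont[OF deriv[OF u0(1,2)]] .
  \<comment> \<open>First passage: \<open>x\<close> falls from infinity to \<xi>.\<close>
  have p1: "sqrt 3 * u1 = W"
    unfolding W_def
  proof (rule time_to_turning_point[where v = "\<lambda>u. V (x u)"])
    have xu: "\<xi> < x u" if "0 < u" "u < u1" for u using decr[of u u1] that u0 u1 by simp
    show "continuous_on {0<..u1} (\<lambda>u. V (x u))"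
    proof (rule contV)
      show "continuous_on {0<..u1} x" by (rule continuous_on_subset[OF cont]) (use u0 u1 in auto)
      show "x u \<noteq> 0" if "u \<in> {0<..u1}" for u using xu[of u] u1 that xi0 by (cases "u = u1") auto
    qed
    fix u assume u: "0 < u" "u < u1"
    have D: "D (x u) > 0" using Dmono[OF xi0 xu[OF u]] Dxi by simp
    show "(V (x u) - l\<^sup>2 / 27)\<^sup>2 < 4 * V (x u) ^ 3"
      by (rule radpos) (use u u0 u1 xu[OF u] xi0 D in auto)
    have "((\<lambda>u. V (x u)) has_real_derivative - (2 / 3) * D (x u) * y u) (at u)"
      by (rule dV) (use u u0 u1 xu[OF u] xi0 D in auto)
    then show "((\<lambda>u. V (x u)) has_real_derivative
        - 2 * sqrt 3 * sqrt (4 * V (x u) ^ 3 - (V (x u) - l\<^sup>2 / 27)\<^sup>2)) (at u)"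
    proof (rule DERIV_cong)
      have "x (u) \<noteq> 0" using xu[OF u] xi0 by simp
      from rad[OF this, unfolded abs_of_pos[OF D]]
      show "- (2 / 3) * D (x u) * y u = - 2 * sqrt 3 * sqrt (4 * V (x u) ^ 3 - (V (x u) - l\<^sup>2 / 27)\<^sup>2)"
        by linarith
    qed
  next
    show "4 * V (x u1) ^ 3 = (V (x u1) - l\<^sup>2 / 27)\<^sup>2"
      by (rule radzero) (use u1 xi0 Dxi in auto)
    show "filterlim (\<lambda>u. V (x u)) at_top (at_right 0)"
      by (rule filterlim_compose[OF Vinf lim])
  qed (use l l1 u1 in auto)
  \<comment> \<open>Second passage: \<open>x\<close> falls from \<xi> to 0, and \<open>V\<close>
    rises to infinity. Time is reversed, starting at \<open>u0\<close>, to obtain a motion from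
    infinity.\<close>
  have p2: "sqrt 3 * (u0 - u1) = W"
    unfolding W_def
  proof (rule time_to_turning_point[where v = "\<lambda>u. V (x (u0 - u))"])
    have xu: "0 < x (u0 - u)" "x (u0 - u) < \<xi>" if "0 < u" "u < u0 - u1" for u
      using decr[of "u0 - u" u0] decr[of u1 "u0 - u"] that u0 u1 by auto
    show "continuous_on {0<..u0 - u1} (\<lambda>u. V (x (u0 - u)))"
    proof (rule contV)
      show "continuous_on {0<..u0 - u1} (\<lambda>u. x (u0 - u))"
        by (rule continuous_on_compose2[OF cont]) (use u0 u1 in \<open>auto intro!: continuous_intros\<close>)
      show "x (u0 - u) \<noteq> 0" if "u \<in> {0<..u0 - u1}" for u
        using xu[of u] u1 that xi0 by (cases "u = u0 - u1") auto
    qed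
    fix u assume u: "0 < u" "u < u0 - u1"
    have D: "D (x (u0 - u)) < 0" using Dmono[OF xu[OF u]] Dxi by simp
    show "(V (x (u0 - u)) - l\<^sup>2 / 27)\<^sup>2 < 4 * V (x (u0 - u)) ^ 3"
      by (rule radpos) (use u u0 u1 xu[OF u] xi0 D in auto)
    have "((\<lambda>u. V (x u)) has_real_derivative - (2 / 3) * D (x (u0 - u)) * y (u0 - u)) (at (u0 - u))"
      by (rule dV) (use u u0 u1 xu[OF u] xi0 D in auto)
    then have "((\<lambda>u. V (x (u0 - u))) has_real_derivative (- (2 / 3) * D (x (u0 - u)) * y (u0 - u)) * (- 1)) (at u)"
      by (rule DERIV_chain2) (auto intro!: derivative_eq_intros)
    then show "((\<lambda>u. V (x (u0 - u))) has_real_derivative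
        - 2 * sqrt 3 * sqrt (4 * V (x (u0 - u)) ^ 3 - (V (x (u0 - u)) - l\<^sup>2 / 27)\<^sup>2)) (at u)"
    proof (rule DERIV_cong)
      have "x (u0 - u) \<noteq> 0" using xu[OF u] by simp
      from rad[OF this, unfolded abs_of_neg[OF D]]
      show "- (2 / 3) * D (x (u0 - u)) * y (u0 - u) * - 1 = - 2 * sqrt 3 * sqrt (4 * V (x (u0 - u)) ^ 3 - (V (x (u0 - u)) - l\<^sup>2 / 27)\<^sup>2)"
        by linarith
    qed
  next
    show "4 * V (x (u0 - (u0 - u1))) ^ 3 = (V (x (u0 - (u0 - u1))) - l\<^sup>2 / 27)\<^sup>2"
      by (rule radzero) (use u1 xi0 Dxi in auto)
    have "filterlim (\<lambda>u. x (u0 - u)) (at 0) (at_right 0)"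
      unfolding filterlim_at
    proof
      have "eventually (\<lambda>u. u < u0 - u1) (at_right 0)" using eventually_at_right_real[of 0 "u0 - u1"] u0 u1 by (auto elim: eventually_mono)
      moreover have "eventually (\<lambda>u::real. 0 < u) (at_right 0)" by (simp add: eventually_at_right_less)
      ultimately show "eventually (\<lambda>u. x (u0 - u) \<in> UNIV \<and> x (u0 - u) \<noteq> 0) (at_right 0)"
      proof eventually_elim
        case (elim u)
        then show ?case using decr[of "u0 - u" u0] u0 u1 by simp
      qed
      have "((\<lambda>u. x (u0 - u)) \<longlongrightarrow> x u0) (at_right 0)"
        by (rule isCont_tendsto_compose[OF x0]) (auto intro!: tendsto_eq_intros)
      then show "((\<lambda>u. x (u0 - u)) \<longlongrightarrow> 0) (at_right 0)" by (simp add: u0)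
    qed
    then show "filterlim (\<lambda>u. V (x (u0 - u))) at_top (at_right 0)"
      by (rule filterlim_compose[OF V0])
  qed (use l l1 u0 u1 in auto)
  \<comment> \<open>Third passage: \<open>x\<close> falls from 0 to the root \<open>x T\<close>, and
    \<open>V\<close> comes down from infinity on the other side of its pole.\<close>
  have p3: "sqrt 3 * (T - u0) = W"
    unfolding W_def
  proof (rule time_to_turning_point[where v = "\<lambda>u. V (x (u0 + u))"])
    have xu: "x (u0 + u) < 0" "- t < x (u0 + u)" if "0 < u" "u \<le> T - u0" for u
      using decr[of u0 "u0 + u"] xneg[of "u0 + u"] that u0 by auto
    show "continuous_on {0<..T - u0} (\<lambda>u. V (x (u0 + u)))"
    proof (rule contV)
      show "continuous_on {0<..T - u0} (\<lambda>u. x (u0 + u))"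
        by (rule continuous_on_compose2[OF cont]) (use u0 u1 in \<open>auto intro!: continuous_intros\<close>)
      show "x (u0 + u) \<noteq> 0" if "u \<in> {0<..T - u0}" for u
        using xu[of u] that by auto
    qed
    fix u assume u: "0 < u" "u < T - u0"
    note xu = xu[OF u(1) less_imp_le[OF u(2)]]
    have D: "D (x (u0 + u)) > 0" using Dneg xu by simp
    show "(V (x (u0 + u)) - l\<^sup>2 / 27)\<^sup>2 < 4 * V (x (u0 + u)) ^ 3"
      by (rule radpos) (use u u0 u1 xu D in auto)
    have "((\<lambda>u. V (x u)) has_real_derivative - (2 / 3) * D (x (u0 + u)) * y (u0 + u)) (at (u0 + u))"
      by (rule dV) (use u u0 u1 xu D in auto)
    then have "((\<lambda>u. V (x (u0 + u))) has_real_derivative (- (2 / 3) * D (x (u0 + u)) * y (u0 + u)) * 1) (at u)"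
      by (rule DERIV_chain2) (auto intro!: derivative_eq_intros)
    then show "((\<lambda>u. V (x (u0 + u))) has_real_derivative
        - 2 * sqrt 3 * sqrt (4 * V (x (u0 + u)) ^ 3 - (V (x (u0 + u)) - l\<^sup>2 / 27)\<^sup>2)) (at u)"
    proof (rule DERIV_cong)
      have "x (u0 + u) \<noteq> 0" using xu by simp
      from rad[OF this, unfolded abs_of_pos[OF D]]
      show "- (2 / 3) * D (x (u0 + u)) * y (u0 + u) * 1 = - 2 * sqrt 3 * sqrt (4 * V (x (u0 + u)) ^ 3 - (V (x (u0 + u)) - l\<^sup>2 / 27)\<^sup>2)"
        by linarith
    qed
  next
    show "4 * V (x (u0 + (T - u0))) ^ 3 = (V (x (u0 + (T - u0))) - l\<^sup>2 / 27)\<^sup>2"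
      by (rule radzero) (use turn xT in \<open>auto simp: t_def\<close>)
    have "filterlim (\<lambda>u. x (u0 + u)) (at 0) (at_right 0)"
      unfolding filterlim_at
    proof
      have "eventually (\<lambda>u. u < T - u0) (at_right 0)" using eventually_at_right_real[of 0 "T - u0"] u0 u1 by (auto elim: eventually_mono)
      moreover have "eventually (\<lambda>u::real. 0 < u) (at_right 0)" by (simp add: eventually_at_right_less)
      ultimately show "eventually (\<lambda>u. x (u0 + u) \<in> UNIV \<and> x (u0 + u) \<noteq> 0) (at_right 0)"
      proof eventually_elim
        case (elim u)
        then show ?case using decr[of u0 "u0 + u"] u0 by simp
      qed
      have "((\<lambda>u. x (u0 + u)) \<longlongrightarrow> x u0) (at_right 0)"
        by (rule isCont_tendsto_compose[OF x0]) (auto intro!: tendsto_eq_intros)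
      then show "((\<lambda>u. x (u0 + u)) \<longlongrightarrow> 0) (at_right 0)" by (simp add: u0)
    qed
    then show "filterlim (\<lambda>u. V (x (u0 + u))) at_top (at_right 0)"
      by (rule filterlim_compose[OF V0])
  qed (use l l1 u0 u1 in auto)
  have "sqrt 3 * T = 3 * W" using p1 p2 p3 by (simp add: algebra_simps)
  then have "sqrt 3 * T = sqrt 3 * (sqrt 3 * W)" by (simp add: mult.assoc[symmetric])
  then show ?thesis by (simp add: W_def)
qed

section \<open>The Weierstrass function of a rectangular lattice\<close>

text \<open>Weierstrass' theorem for unordered sums: a majorant for the terms on a closed disc makes
  the finite partial sums converge uniformly, and for holomorphic functions the derivatives then
  converge as well.\<close>

lemma infsum_has_field_derivative:
  fixes f f' :: "'a \<Rightarrow> complex \<Rightarrow> complex"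
  assumes r: "0 < r"
    and d: "\<And>w z. w \<in> A \<Longrightarrow> z \<in> cball z0 r \<Longrightarrow> (f w has_field_derivative f' w z) (at z)"
    and M: "\<And>w z. w \<in> A \<Longrightarrow> z \<in> cball z0 r \<Longrightarrow> norm (f w z) \<le> M w"
    and sM: "M summable_on A"
  shows "((\<lambda>z. \<Sum>\<^sub>\<infinity>w\<in>A. f w z) has_field_derivative (\<Sum>\<^sub>\<infinity>w\<in>A. f' w z0)) (at z0)"
proof -
  have ev: "eventually (\<lambda>X. continuous_on (cball z0 r) (\<lambda>z. \<Sum>w\<in>X. f w z) \<and>
      (\<forall>z\<in>ball z0 r. ((\<lambda>z. \<Sum>w\<in>X. f w z) has_field_derivative (\<Sum>w\<in>X. f' w z)) (at z))) (finite_subsets_at_top A)"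
  proof (rule eventually_finite_subsets_at_top_weakI)
    fix X assume X: "finite X" "X \<subseteq> A"
    have *: "((\<lambda>z. \<Sum>w\<in>X. f w z) has_field_derivative (\<Sum>w\<in>X. f' w z)) (at z)" if "z \<in> cball z0 r" for z
      using X that by (intro DERIV_sum d) auto
    then have "continuous_on (cball z0 r) (\<lambda>z. \<Sum>w\<in>X. f w z)"
      by (intro continuous_at_imp_continuous_on ballI) (blast intro: DERIV_isCont)
    with * show "continuous_on (cball z0 r) (\<lambda>z. \<Sum>w\<in>X. f w z) \<and>
      (\<forall>z\<in>ball z0 r. ((\<lambda>z. \<Sum>w\<in>X. f w z) has_field_derivative (\<Sum>w\<in>X. f' w z)) (at z))" by auto
  qed
  have ul: "uniform_limit (cball z0 r) (\<lambda>X z. \<Sum>w\<in>X. f w z) (\<lambda>z. \<Sum>\<^sub>\<infinity>w\<in>A. f w z) (finite_subsets_at_top A)"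
    using M sM by (rule Weierstrass_m_test_general)
  obtain g' where g': "\<And>z. z \<in> ball z0 r \<Longrightarrow> ((\<lambda>z. \<Sum>\<^sub>\<infinity>w\<in>A. f w z) has_field_derivative g' z) (at z) \<and>
      ((\<lambda>X. \<Sum>w\<in>X. f' w z) \<longlongrightarrow> g' z) (finite_subsets_at_top A)"
    using has_complex_derivative_uniform_limit[OF ev ul finite_subsets_at_top_neq_bot r] by blast
  have z0: "z0 \<in> ball z0 r" using r by simp
  have "(\<Sum>\<^sub>\<infinity>w\<in>A. f' w z0) = g' z0"
    using g'[OF z0] by (intro infsumI) (simp add: has_sum_def)
  then show ?thesis using g'[OF z0] by simp
qed

text \<open>The exponent is half of -3: a product of two such one-dimensional sums will dominate the
  sum of inverse cubes over a plane lattice.\<close>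

lemma summable_on_int_powr:
  "(\<lambda>m::int. (1 + \<bar>real_of_int m\<bar>) powr (- 3 / 2)) summable_on UNIV"
proof -
  let ?h = "\<lambda>m::int. (1 + \<bar>real_of_int m\<bar>) powr (- 3 / 2)"
  have "summable (\<lambda>n. real n powr (- 3 / 2))" by (subst summable_real_powr_iff) simp
  then have "summable (\<lambda>n. real (Suc n) powr (- 3 / 2))" by (subst summable_Suc_iff)
  then have s: "(\<lambda>n::nat. (1 + real n) powr (- 3 / 2)) summable_on UNIV"
    by (subst summable_on_UNIV_nonneg_real_iff) (auto simp: add.commute)
  have "?h summable_on (int ` UNIV)"
    using s by (subst summable_on_reindex) (auto simp: o_def)
  moreover have "?h summable_on ((\<lambda>n. - int n) ` UNIV)"
    using s by (subst summable_on_reindex) (auto simp: o_def inj_on_def)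
  ultimately have "?h summable_on (int ` UNIV \<union> (\<lambda>n. - int n) ` UNIV)"
    by (rule summable_on_union)
  moreover have "int ` UNIV \<union> (\<lambda>n. - int n) ` UNIV = UNIV"
  proof -
    have "m \<in> int ` UNIV \<union> (\<lambda>n. - int n) ` UNIV" for m :: int
      by (cases m rule: int_cases2) auto
    then show ?thesis by auto
  qed
  ultimately show ?thesis by simp
qed

text \<open>The discriminant is 16 times the squared product of the root differences. Subtracting
  the equations pairwise shows that the roots sum to 0, which eliminates \<open>z\<close>.\<close>

lemma cubic_three_real_roots:
  fixes p q x y z :: real
  assumes "4 * x ^ 3 - p * x - q = 0" "4 * y ^ 3 - p * y - q = 0" "4 * z ^ 3 - p * z - q = 0"
    and "x \<noteq> y" "y \<noteq> z" "x \<noteq> z"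
  shows "0 < p" "27 * q\<^sup>2 < p ^ 3"
proof -
  have "(x - y) * (4 * (x\<^sup>2 + x * y + y\<^sup>2) - p) = 0"
    using assms(1,2) by (simp add: power2_eq_square power3_eq_cube algebra_simps)
  then have p: "p = 4 * (x\<^sup>2 + x * y + y\<^sup>2)" using assms by simp
  have "(x - z) * (4 * (x\<^sup>2 + x * z + z\<^sup>2) - p) = 0"
    using assms(1,3) by (simp add: power2_eq_square power3_eq_cube algebra_simps)
  then have "p = 4 * (x\<^sup>2 + x * z + z\<^sup>2)" using assms by simp
  with p have "(y - z) * (x + y + z) = 0" by (simp add: power2_eq_square algebra_simps)
  then have z: "z = - x - y" using assms by simp
  have q: "q = - 4 * x * y * (x + y)"
    using assms(1) unfolding p by (simp add: power2_eq_square power3_eq_cube algebra_simps)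
  have pp: "p = (x - y)\<^sup>2 + 3 * (x + y)\<^sup>2"
    unfolding p by (simp add: power2_eq_square algebra_simps)
  have "0 < (x - y)\<^sup>2" "0 \<le> 3 * (x + y)\<^sup>2" using assms by auto
  then show "0 < p" unfolding pp by linarith
  have "p ^ 3 - 27 * q\<^sup>2 = 16 * ((x - y) * (x - z) * (y - z))\<^sup>2"
    unfolding p q z by (simp add: power2_eq_square power3_eq_cube algebra_simps)
  moreover have "0 < 16 * ((x - y) * (x - z) * (y - z))\<^sup>2" using assms by simp
  ultimately show "27 * q\<^sup>2 < p ^ 3" by linarith
qed

section \<open>Rectangular lattices as discrete subgroups of the plane\<close>

locale rect_lattice =
  fixes a b :: real
  assumes a: "0 < a" and b: "0 < b"
begin

definition L :: "complex set" where
  "L = lattice (2 * complex_of_real a) (2 * (\<i> * complex_of_real b))"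

lemma L_iff: "w \<in> L \<longleftrightarrow> (\<exists>m n. w = Complex (2 * a * of_int m) (2 * b * of_int n))"
  unfolding L_def lattice_def by (auto simp: complex_eq_iff mult_ac)

lemma L_0 [simp]: "0 \<in> L"
  unfolding L_iff by (rule exI[of _ 0], rule exI[of _ 0]) (simp add: complex_eq_iff)

lemma L_add: "w \<in> L \<Longrightarrow> w' \<in> L \<Longrightarrow> w + w' \<in> L"
proof -
  assume "w \<in> L" "w' \<in> L"
  then obtain m n m' n' where "w = Complex (2 * a * of_int m) (2 * b * of_int n)"
    "w' = Complex (2 * a * of_int m') (2 * b * of_int n')" unfolding L_iff by blast
  then have "w + w' = Complex (2 * a * of_int (m + m')) (2 * b * of_int (n + n'))"
    by (simp add: complex_eq_iff algebra_simps)
  then show ?thesis unfolding L_iff by blast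
qed

lemma L_uminus: "w \<in> L \<Longrightarrow> - w \<in> L"
proof -
  assume "w \<in> L"
  then obtain m n where "w = Complex (2 * a * of_int m) (2 * b * of_int n)" unfolding L_iff by blast
  then have "- w = Complex (2 * a * of_int (- m)) (2 * b * of_int (- n))"
    by (simp add: complex_eq_iff)
  then show ?thesis unfolding L_iff by blast
qed

lemma L_cnj: "w \<in> L \<Longrightarrow> cnj w \<in> L"
proof -
  assume "w \<in> L"
  then obtain m n where "w = Complex (2 * a * of_int m) (2 * b * of_int n)" unfolding L_iff by blast
  then have "cnj w = Complex (2 * a * of_int m) (2 * b * of_int (- n))"
    by (simp add: complex_eq_iff)
  then show ?thesis unfolding L_iff by blast
qed

lemma L_uminus_iff [simp]: "- w \<in> L \<longleftrightarrow> w \<in> L"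
  using L_uminus[of w] L_uminus[of "- w"] by auto

lemma L_cnj_iff [simp]: "cnj w \<in> L \<longleftrightarrow> w \<in> L"
  using L_cnj[of w] L_cnj[of "cnj w"] by auto

lemma L_diff: "w \<in> L \<Longrightarrow> w' \<in> L \<Longrightarrow> w - w' \<in> L"
  using L_add[of w "- w'"] by simp

lemma L_add_iff: "w \<in> L \<Longrightarrow> z + w \<in> L \<longleftrightarrow> z \<in> L"
  using L_add[of z w] L_diff[of "z + w" w] by auto

lemma L_diff_iff: "w \<in> L \<Longrightarrow> z - w \<in> L \<longleftrightarrow> z \<in> L"
  using L_add_iff[of "- w" z] by simp

lemma L_reduce:
  "\<exists>w\<in>L. z - w \<in> cbox 0 (Complex (2 * a) (2 * b))"
proof -
  define m where "m = \<lfloor>Re z / (2 * a)\<rfloor>"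
  define n where "n = \<lfloor>Im z / (2 * b)\<rfloor>"
  have "of_int m \<le> Re z / (2 * a)" "Re z / (2 * a) \<le> of_int m + 1"
    "of_int n \<le> Im z / (2 * b)" "Im z / (2 * b) \<le> of_int n + 1"
    unfolding m_def n_def by linarith+
  then have "z - Complex (2 * a * of_int m) (2 * b * of_int n) \<in> cbox 0 (Complex (2 * a) (2 * b))"
    using a b by (auto simp: in_cbox_complex_iff field_simps)
  moreover have "Complex (2 * a * of_int m) (2 * b * of_int n) \<in> L" unfolding L_iff by blast
  ultimately show ?thesis by blast
qed

definition gap :: real where "gap = 2 * min a b"

lemma gap_pos: "0 < gap" using a b by (simp add: gap_def)

lemma norm_L_ge:
  "gap * \<bar>of_int m\<bar> \<le> norm (Complex (2 * a * of_int m) (2 * b * of_int n))"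
  "gap * \<bar>of_int n\<bar> \<le> norm (Complex (2 * a * of_int m) (2 * b * of_int n))"
proof -
  have "gap * \<bar>of_int m\<bar> \<le> 2 * a * \<bar>of_int m\<bar>" "gap * \<bar>of_int n\<bar> \<le> 2 * b * \<bar>of_int n\<bar>"
    unfolding gap_def by (intro mult_right_mono; simp)+
  then show "gap * \<bar>of_int m\<bar> \<le> norm (Complex (2 * a * of_int m) (2 * b * of_int n))"
    "gap * \<bar>of_int n\<bar> \<le> norm (Complex (2 * a * of_int m) (2 * b * of_int n))"
    using abs_Re_le_cmod[of "Complex (2 * a * of_int m) (2 * b * of_int n)"]
      abs_Im_le_cmod[of "Complex (2 * a * of_int m) (2 * b * of_int n)"] a b
    by (auto simp: abs_mult)
qed

lemma gap_le: "w \<in> L \<Longrightarrow> w \<noteq> 0 \<Longrightarrow> gap \<le> norm w"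
proof -
  assume w: "w \<in> L" "w \<noteq> 0"
  then obtain m n where mn: "w = Complex (2 * a * of_int m) (2 * b * of_int n)" unfolding L_iff by blast
  then have "m \<noteq> 0 \<or> n \<noteq> 0" using w by (auto simp: complex_eq_iff)
  then have "1 \<le> \<bar>real_of_int m\<bar> \<or> 1 \<le> \<bar>real_of_int n\<bar>" by linarith
  then have "gap * 1 \<le> gap * \<bar>real_of_int m\<bar> \<or> gap * 1 \<le> gap * \<bar>real_of_int n\<bar>"
    using gap_pos by (metis mult_left_mono less_imp_le)
  then show ?thesis using norm_L_ge[where m = m and n = n] mn by force
qed

lemma eventually_notin_L: "eventually (\<lambda>z. z \<notin> L) (at z0)"
proof (cases "\<exists>w\<in>L. w \<noteq> z0 \<and> dist w z0 < gap / 2")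
  case True
  then obtain w where w: "w \<in> L" "w \<noteq> z0" "dist w z0 < gap / 2" by blast
  have "z \<notin> L" if "z \<noteq> z0" "dist z z0 < dist w z0" for z
  proof
    assume "z \<in> L"
    then have "z = w \<or> gap \<le> norm (z - w)" using gap_le[OF L_diff[of z w]] w by auto
    moreover have "norm (z - w) \<le> dist z z0 + dist w z0"
      using dist_triangle2[of z w z0] by (simp add: dist_norm)
    ultimately show False using w that by auto
  qed
  then show ?thesis unfolding eventually_at using w by (intro exI[of _ "dist w z0"]) auto
next
  case False
  then show ?thesis unfolding eventually_at using gap_pos by (intro exI[of _ "gap / 2"]) auto
qed

lemma closed_L: "closed L"
  unfolding closed_limpt islimpt_iff_eventually using eventually_notin_L by blast

lemma countable_L: "countable L"
proof -
  have "L = (\<lambda>(m, n). Complex (2 * a * of_int m) (2 * b * of_int n)) ` UNIV"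
    using L_iff by (auto simp: image_iff)
  then show ?thesis by (metis countableI_type countable_image)
qed

lemma connected_Compl_L: "connected (- L)"
  using path_connected_complement_countable[OF _ countable_L] by (simp add: path_connected_imp_connected)

section \<open>Convergence and differentiation of the lattice sums\<close>

lemma summable_cube: "(\<lambda>w. 1 / norm w ^ 3) summable_on (L - {0})"
proof -
  let ?f = "\<lambda>(m, n). Complex (2 * a * of_int m) (2 * b * of_int n)"
  let ?h = "\<lambda>m::int. (1 + \<bar>real_of_int m\<bar>) powr (- 3 / 2)"
  have inj: "inj ?f" using a b by (auto simp: inj_on_def complex_eq_iff)
  have im: "L - {0} = ?f ` (UNIV - {(0, 0)})"
    using a b by (force simp: L_iff image_iff complex_eq_iff)
  have "(\<lambda>(m, n). ?h m * ?h n) summable_on Sigma (UNIV :: int set) (\<lambda>_. UNIV :: int set)"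
  proof (rule summable_on_SigmaI)
    show "((\<lambda>n. (\<lambda>(m, n). ?h m * ?h n) (m, n)) has_sum ?h m * infsum ?h UNIV) UNIV" for m
      using has_sum_cmult_right[OF has_sum_infsum[OF summable_on_int_powr]] by simp
    show "(\<lambda>m. ?h m * infsum ?h UNIV) summable_on UNIV"
      by (rule summable_on_cmult_left[OF summable_on_int_powr])
  qed auto
  then have "(\<lambda>(m, n). ?h m * ?h n) summable_on (UNIV - {(0, 0)})"
    by (rule summable_on_subset) auto
  then have "(\<lambda>p. (2 / gap) ^ 3 * (case p of (m, n) \<Rightarrow> ?h m * ?h n)) summable_on (UNIV - {(0, 0)})"
    by (rule summable_on_cmult_right)
  then have "((\<lambda>w. 1 / norm w ^ 3) \<circ> ?f) summable_on (UNIV - {(0, 0)})"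
  proof (rule summable_on_comparison_test)
    fix p :: "int \<times> int" assume "p \<in> UNIV - {(0, 0)}"
    then obtain m n where p: "p = (m, n)" "m \<noteq> 0 \<or> n \<noteq> 0" by (cases p) auto
    let ?w = "Complex (2 * a * of_int m) (2 * b * of_int n)"
    define x where "x = 1 + \<bar>real_of_int m\<bar>"
    define y where "y = 1 + \<bar>real_of_int n\<bar>"
    have xy: "1 \<le> x" "1 \<le> y" by (auto simp: x_def y_def)
    have "x \<le> 2 * \<bar>real_of_int m\<bar> \<or> x \<le> 2 * \<bar>real_of_int n\<bar>"
      "y \<le> 2 * \<bar>real_of_int m\<bar> \<or> y \<le> 2 * \<bar>real_of_int n\<bar>"
      using p(2) unfolding x_def y_def by linarith+
    then have "gap / 2 * x \<le> gap / 2 * (2 * \<bar>real_of_int m\<bar>) \<or> gap / 2 * x \<le> gap / 2 * (2 * \<bar>real_of_int n\<bar>)"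
      "gap / 2 * y \<le> gap / 2 * (2 * \<bar>real_of_int m\<bar>) \<or> gap / 2 * y \<le> gap / 2 * (2 * \<bar>real_of_int n\<bar>)"
      using gap_pos by (simp_all only: mult_le_cancel_left_pos half_gt_zero_iff)
    \<comment> \<open>Both lower bounds together bound the norm below by their geometric mean, whose
      inverse cube separates into a function of \<open>m\<close> times a function of
      \<open>n\<close>.\<close>
    then have "gap / 2 * x \<le> norm ?w" "gap / 2 * y \<le> norm ?w"
      using norm_L_ge[where m = m and n = n] by auto
    then have "(gap / 2 * x) * (gap / 2 * y) \<le> norm ?w * norm ?w"
      using gap_pos xy by (intro mult_mono) auto
    then have "sqrt ((gap / 2 * x) * (gap / 2 * y)) \<le> norm ?w"
      by (intro real_le_lsqrt) (auto simp: power2_eq_square)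
    moreover have "sqrt ((gap / 2 * x) * (gap / 2 * y)) = gap / 2 * sqrt (x * y)"
      using gap_pos by (simp add: real_sqrt_mult real_sqrt_divide)
    ultimately have "(gap / 2 * sqrt (x * y)) ^ 3 \<le> norm ?w ^ 3"
      using gap_pos xy by (intro power_mono) auto
    moreover have pos: "0 < (gap / 2 * sqrt (x * y)) ^ 3" using gap_pos xy by simp
    ultimately have "1 / norm ?w ^ 3 \<le> 1 / (gap / 2 * sqrt (x * y)) ^ 3"
      by (intro divide_left_mono) (auto intro!: mult_pos_pos)
    also have "sqrt (x * y) ^ 3 = (x * y) powr (3 / 2)"
      using xy powr_powr[of "x * y" "1/2" 3] by (simp add: powr_half_sqrt[symmetric] powr_numeral)
    then have "1 / (gap / 2 * sqrt (x * y)) ^ 3 = (2 / gap) ^ 3 * (x powr (- 3 / 2) * y powr (- 3 / 2))"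
      using xy by (simp add: power_mult_distrib powr_mult powr_minus_divide power_divide)
    finally show "((\<lambda>w. 1 / norm w ^ 3) \<circ> ?f) p \<le> (2 / gap) ^ 3 * (case p of (m, n) \<Rightarrow> ?h m * ?h n)"
      by (simp add: p x_def y_def)
  qed (auto simp: split_def)
  then show ?thesis unfolding im by (subst summable_on_reindex) (auto intro: inj_on_subset[OF inj])
qed

lemma summable_power:
  assumes "3 \<le> k"
  shows "(\<lambda>w. 1 / norm w ^ k) summable_on (L - {0})"
proof (rule summable_on_comparison_test)
  show "(\<lambda>w. 1 / gap ^ (k - 3) * (1 / norm w ^ 3)) summable_on (L - {0})"
    by (rule summable_on_cmult_right[OF summable_cube])
  fix w assume w: "w \<in> L - {0}"
  then have g: "gap \<le> norm w" "0 < norm w" using gap_le by auto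
  then have "gap ^ (k - 3) * norm w ^ 3 \<le> norm w ^ (k - 3) * norm w ^ 3"
    using gap_pos by (intro mult_right_mono power_mono) auto
  also have "\<dots> = norm w ^ k" using assms by (simp flip: power_add)
  finally show "1 / norm w ^ k \<le> 1 / gap ^ (k - 3) * (1 / norm w ^ 3)"
    using gap_pos g by (simp add: divide_simps)
qed auto

text \<open>One constant serves a whole disc around \<open>z0\<close>, so it yields a majorant for
  the lattice sums there. Distant \<open>w\<close> satisfy it with 1/2 by the triangle inequality;
  for the others the distance from \<open>w\<close> to the disc is at least \<open>r\<close>. Only
  nonzero lattice points are kept away, which admits \<open>z0 = 0\<close>.\<close>

lemma dist_L_lower_bound:
  assumes "z0 \<notin> L - {0}"
  obtains r \<delta> where "0 < r" "0 < \<delta>"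
    "\<And>z w. z \<in> cball z0 r \<Longrightarrow> w \<in> L - {0} \<Longrightarrow> \<delta> * norm w \<le> norm (z - w)"
proof -
  obtain e where e: "0 < e" "\<And>z. z \<noteq> z0 \<Longrightarrow> dist z z0 < e \<Longrightarrow> z \<notin> L"
    using eventually_notin_L[of z0] unfolding eventually_at by auto
  define r where "r = e / 2"
  define \<delta> where "\<delta> = min (1/2) (r / (2 * (norm z0 + r)))"
  have r: "0 < r" using e by (simp add: r_def)
  have nr: "0 < norm z0 + r" using r by (simp add: add_nonneg_pos)
  have dl: "0 < \<delta>" using r nr by (simp add: \<delta>_def)
  show ?thesis
  proof (rule that[OF r dl])
    fix z w assume z: "z \<in> cball z0 r" and w: "w \<in> L - {0}"
    have "w \<noteq> z0" using w assms by auto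
    then have "e \<le> dist w z0" using e(2)[of w] w by force
    then have far: "r \<le> norm (z - w)"
      using z dist_triangle2[of w z0 z] by (simp add: r_def dist_norm dist_commute norm_minus_commute)
    show "\<delta> * norm w \<le> norm (z - w)"
    proof (cases "2 * (norm z0 + r) \<le> norm w")
      case True
      have "norm z \<le> norm z0 + r"
        using z norm_triangle_ineq2[of z z0] by (simp add: dist_norm norm_minus_commute)
      then have "norm w / 2 \<le> norm (z - w)"
        using True norm_triangle_ineq2[of w z] by (simp add: norm_minus_commute)
      moreover have "\<delta> * norm w \<le> 1/2 * norm w" 
        unfolding \<delta>_def by (intro mult_right_mono min.cobounded1) simp
      ultimately show ?thesis by simp
    next
      case False
      have "\<delta> * norm w \<le> r / (2 * (norm z0 + r)) * (2 * (norm z0 + r))"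
        using False r nr dl by (intro mult_mono) (auto simp: \<delta>_def)
      also have "\<dots> = r" using nr by simp
      finally show ?thesis using far by simp
    qed
  qed
qed

text \<open>Leaving out \<open>w = 0\<close> keeps these functions regular at the origin, where they
  supply Taylor coefficients; \<open>E 4 0\<close> and \<open>E 6 0\<close> are the Eisenstein sums
  of the invariants.\<close>

definition E :: "nat \<Rightarrow> complex \<Rightarrow> complex" where
  "E k z = (\<Sum>\<^sub>\<infinity>w\<in>L - {0}. 1 / (z - w) ^ k)"

definition H :: "complex \<Rightarrow> complex" where
  "H z = (\<Sum>\<^sub>\<infinity>w\<in>L - {0}. 1 / (z - w)\<^sup>2 - 1 / w\<^sup>2)"

lemma norm_E_term:
  fixes z w :: complex
  assumes "0 < \<delta>" "\<delta> * norm w \<le> norm (z - w)" "w \<noteq> 0"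
  shows "norm (1 / (z - w) ^ k) \<le> 1 / \<delta> ^ k * (1 / norm w ^ k)"
proof -
  have "(\<delta> * norm w) ^ k \<le> norm (z - w) ^ k" using assms by (intro power_mono) auto
  moreover have "0 < (\<delta> * norm w) ^ k" using assms by simp
  ultimately have "1 / norm (z - w) ^ k \<le> 1 / (\<delta> * norm w) ^ k"
    by (intro divide_left_mono) (auto intro!: mult_pos_pos)
  then show ?thesis by (simp add: norm_divide norm_power power_mult_distrib)
qed

lemma summable_E:
  assumes "z \<notin> L - {0}" "3 \<le> k"
  shows "(\<lambda>w. 1 / (z - w) ^ k) summable_on (L - {0})"
proof -
  obtain r \<delta> where rd: "0 < r" "0 < \<delta>"
    "\<And>y w. y \<in> cball z r \<Longrightarrow> w \<in> L - {0} \<Longrightarrow> \<delta> * norm w \<le> norm (y - w)"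
    using dist_L_lower_bound[OF assms(1)] by blast
  have "(\<lambda>w. norm (1 / (z - w) ^ k)) summable_on (L - {0})"
  proof (rule summable_on_comparison_test)
    show "(\<lambda>w. 1 / \<delta> ^ k * (1 / norm w ^ k)) summable_on (L - {0})"
      by (rule summable_on_cmult_right[OF summable_power[OF assms(2)]])
    show "norm (1 / (z - w) ^ k) \<le> 1 / \<delta> ^ k * (1 / norm w ^ k)" if "w \<in> L - {0}" for w
      using norm_E_term[OF rd(2)] rd(3)[of z w] rd(1) that by auto
  qed auto
  then show ?thesis by (rule abs_summable_summable)
qed

lemma E_deriv:
  assumes "z \<notin> L - {0}" "3 \<le> k"
  shows "(E k has_field_derivative - of_nat k * E (Suc k) z) (at z)"
proof -
  obtain r \<delta> where rd: "0 < r" "0 < \<delta>"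
    "\<And>y w. y \<in> cball z r \<Longrightarrow> w \<in> L - {0} \<Longrightarrow> \<delta> * norm w \<le> norm (y - w)"
    using dist_L_lower_bound[OF assms(1)] by blast
  have "((\<lambda>z. \<Sum>\<^sub>\<infinity>w\<in>L - {0}. 1 / (z - w) ^ k) has_field_derivative
      (\<Sum>\<^sub>\<infinity>w\<in>L - {0}. - of_nat k * (1 / (z - w) ^ Suc k))) (at z)"
  proof (rule infsum_has_field_derivative[OF rd(1)])
    fix w y assume wy: "w \<in> L - {0}" "y \<in> cball z r"
    then have "0 < \<delta> * norm w" using rd(2) by simp
    then have ne: "y - w \<noteq> 0" using rd(3)[OF wy(2,1)] by auto
    obtain j where k: "k = Suc j" using assms(2) by (cases k) auto
    show "((\<lambda>z. 1 / (z - w) ^ k) has_field_derivative - of_nat k * (1 / (y - w) ^ Suc k)) (at y)"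
      unfolding k using ne
      by (intro DERIV_cong[OF DERIV_divide[OF DERIV_const DERIV_power[OF DERIV_diff[OF DERIV_ident DERIV_const]]]])
         (auto simp: divide_simps)
    show "norm (1 / (y - w) ^ k) \<le> 1 / \<delta> ^ k * (1 / norm w ^ k)"
      using norm_E_term[OF rd(2) rd(3)[OF wy(2,1)]] wy by auto
  qed (rule summable_on_cmult_right[OF summable_power[OF assms(2)]])
  then show ?thesis unfolding E_def[abs_def] by (subst (asm) infsum_cmult_right') 
qed

lemma H_deriv:
  assumes "z \<notin> L - {0}"
  shows "(H has_field_derivative - 2 * E 3 z) (at z)"
proof -
  obtain r \<delta> where rd: "0 < r" "0 < \<delta>"
    "\<And>y w. y \<in> cball z r \<Longrightarrow> w \<in> L - {0} \<Longrightarrow> \<delta> * norm w \<le> norm (y - w)"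
    using dist_L_lower_bound[OF assms(1)] by blast
  define B where "B = norm z + r"
  have "((\<lambda>z. \<Sum>\<^sub>\<infinity>w\<in>L - {0}. 1 / (z - w)\<^sup>2 - 1 / w\<^sup>2) has_field_derivative
      (\<Sum>\<^sub>\<infinity>w\<in>L - {0}. - 2 * (1 / (z - w) ^ 3))) (at z)"
  proof (rule infsum_has_field_derivative[OF rd(1)])
    fix w y assume wy: "w \<in> L - {0}" "y \<in> cball z r"
    then have w0: "0 < norm w" "w \<noteq> 0" by auto
    then have dw: "0 < \<delta> * norm w" using rd(2) by simp
    have le: "\<delta> * norm w \<le> norm (y - w)" using rd(3)[OF wy(2,1)] .
    then have ne: "y - w \<noteq> 0" using dw by auto
    show "((\<lambda>z. 1 / (z - w)\<^sup>2 - 1 / w\<^sup>2) has_field_derivative - 2 * (1 / (y - w) ^ 3)) (at y)"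
      using ne
      by (intro DERIV_cong[OF DERIV_diff[OF DERIV_divide[OF DERIV_const DERIV_power[OF DERIV_diff[OF DERIV_ident DERIV_const]]] DERIV_const]])
         (auto simp: divide_simps power2_eq_square power3_eq_cube)
    have yB: "norm y \<le> B"
      using wy(2) norm_triangle_ineq2[of y z] by (simp add: B_def dist_norm norm_minus_commute)
    let ?s = "norm (y - w)"
    \<comment> \<open>The difference of squares factors, and its numerator grows only linearly in
      \<open>w\<close>. This is how the correction term gains one order and brings the summand down
      to an inverse cube.\<close>
    have "1 / (y - w)\<^sup>2 - 1 / w\<^sup>2 = y * (w - (y - w)) / ((y - w)\<^sup>2 * w\<^sup>2)"
      using ne w0 by (simp add: divide_simps) (simp add: power2_eq_square algebra_simps)
    then have "norm (1 / (y - w)\<^sup>2 - 1 / w\<^sup>2) = norm y * norm (w - (y - w)) / (?s\<^sup>2 * (norm w)\<^sup>2)"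
      by (simp add: norm_divide norm_mult norm_power)
    also have "\<dots> \<le> B * (norm w + ?s) / (?s\<^sup>2 * (norm w)\<^sup>2)"
      using yB by (intro divide_right_mono mult_mono norm_triangle_ineq4)
        (auto intro: order_trans[OF norm_ge_zero yB])
    also have "\<dots> = B * (1 / (?s\<^sup>2 * norm w) + 1 / (?s * (norm w)\<^sup>2))"
      using ne w0 by (simp add: divide_simps) (simp add: power2_eq_square algebra_simps)
    also have "\<dots> \<le> B * (1 / ((\<delta> * norm w)\<^sup>2 * norm w) + 1 / ((\<delta> * norm w) * (norm w)\<^sup>2))"
      using le dw w0 ne rd(2) order_trans[OF norm_ge_zero yB]
      by (intro mult_left_mono add_mono divide_left_mono mult_right_mono power_mono mult_pos_pos) auto
    also have "\<dots> = B * (1 / \<delta>\<^sup>2 + 1 / \<delta>) * (1 / norm w ^ 3)"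
      using rd(2) w0 by (simp add: divide_simps) (simp add: power2_eq_square power3_eq_cube algebra_simps)
    finally show "norm (1 / (y - w)\<^sup>2 - 1 / w\<^sup>2) \<le> B * (1 / \<delta>\<^sup>2 + 1 / \<delta>) * (1 / norm w ^ 3)" .
  qed (rule summable_on_cmult_right[OF summable_cube])
  then show ?thesis unfolding H_def[abs_def] E_def by (subst (asm) infsum_cmult_right')
qed

section \<open>The Weierstrass function: symmetries, periods, and Liouville's theorem\<close>

definition wp :: "complex \<Rightarrow> complex" where "wp z = 1 / z\<^sup>2 + H z"

definition wp' :: "complex \<Rightarrow> complex" where "wp' z = - 2 / z ^ 3 - 2 * E 3 z"

lemma wp_deriv:
  assumes "z \<notin> L"
  shows "(wp has_field_derivative wp' z) (at z)"
proof -
  have z: "z \<noteq> 0" using assms by auto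
  have "((\<lambda>z. 1 / z\<^sup>2) has_field_derivative - 2 / z ^ 3) (at z)"
    using z
    by (intro DERIV_cong[OF DERIV_divide[OF DERIV_const DERIV_power[OF DERIV_ident]]])
       (auto simp: divide_simps power2_eq_square power3_eq_cube)
  from DERIV_add[OF this H_deriv] assms show ?thesis
    unfolding wp_def[abs_def] wp'_def by simp
qed

text \<open>With the principal part absorbed, the sum runs over the whole lattice and is visibly
  invariant under translation by it.\<close>

lemma wp'_eq_infsum:
  assumes "z \<notin> L"
  shows "wp' z = - 2 * (\<Sum>\<^sub>\<infinity>w\<in>L. 1 / (z - w) ^ 3)"
proof -
  have "L = insert 0 (L - {0})" by auto
  then have "(\<Sum>\<^sub>\<infinity>w\<in>L. 1 / (z - w) ^ 3) = (\<Sum>\<^sub>\<infinity>w\<in>insert 0 (L - {0}). 1 / (z - w) ^ 3)" by simp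
  also have "\<dots> = 1 / (z - 0) ^ 3 + E 3 z"
    unfolding E_def using assms by (intro infsum_insert summable_E) auto
  finally show ?thesis by (simp add: wp'_def)
qed

lemma wp'_periodic:
  assumes "z \<notin> L" "w \<in> L"
  shows "wp' (z + w) = wp' z"
proof -
  have "(\<Sum>\<^sub>\<infinity>v\<in>L. 1 / (z + w - v) ^ 3) = (\<Sum>\<^sub>\<infinity>v\<in>L. 1 / (z - v) ^ 3)"
    by (rule infsum_reindex_bij_witness[of _ "\<lambda>v. v + w" "\<lambda>v. v - w"])
       (auto simp: L_add_iff L_diff_iff assms algebra_simps)
  then show ?thesis using assms by (simp add: wp'_eq_infsum L_add_iff)
qed

lemma H_even: "H (- z) = H z"
  unfolding H_def
  by (rule infsum_reindex_bij_witness[of _ uminus uminus])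
     (auto simp: power2_commute algebra_simps)

lemma E_uminus: "E k (- z) = (- 1) ^ k * E k z"
proof -
  have "E k (- z) = (\<Sum>\<^sub>\<infinity>w\<in>L - {0}. (- 1) ^ k * (1 / (z - w) ^ k))"
    unfolding E_def
  proof (rule infsum_reindex_bij_witness[of _ uminus uminus])
    fix w
    have "(- z - w) ^ k = (- 1) ^ k * (z - - w) ^ k" by (simp flip: power_mult_distrib)
    then show "(- 1) ^ k * (1 / (z - - w) ^ k) = 1 / (- z - w) ^ k"
      by (cases "even k") auto
  qed auto
  then show ?thesis unfolding E_def by (simp only: infsum_cmult_right')
qed

lemma E_odd_0: "odd k \<Longrightarrow> E k 0 = 0"
  using E_uminus[of k 0] by simp

lemma wp_even: "wp (- z) = wp z"
  by (simp add: wp_def H_even)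

lemma wp'_odd: "wp' (- z) = - wp' z"
  by (simp add: wp'_def E_uminus)

lemma wp_cnj: "wp (cnj z) = cnj (wp z)"
proof -
  have "H (cnj z) = (\<Sum>\<^sub>\<infinity>w\<in>L - {0}. cnj (1 / (z - w)\<^sup>2 - 1 / w\<^sup>2))"
    unfolding H_def by (rule infsum_reindex_bij_witness[of _ cnj cnj]) auto
  then have "H (cnj z) = cnj (H z)" by (simp add: H_def del: complex_cnj_diff complex_cnj_divide)
  then show ?thesis by (simp add: wp_def)
qed

lemma E_cnj: "E k (cnj z) = cnj (E k z)"
proof -
  have "E k (cnj z) = (\<Sum>\<^sub>\<infinity>w\<in>L - {0}. cnj (1 / (z - w) ^ k))"
    unfolding E_def by (rule infsum_reindex_bij_witness[of _ cnj cnj]) auto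
  then show ?thesis by (simp add: E_def del: complex_cnj_diff complex_cnj_divide)
qed

lemma wp'_cnj: "wp' (cnj z) = cnj (wp' z)"
  by (simp add: wp'_def E_cnj)

text \<open>The correction terms hide the periodicity in the series itself. Periodicity of the
  derivative leaves an additive constant on the connected complement of \<open>L\<close>, and
  evenness shows that it equals its own negative.\<close>

lemma wp_periodic:
  assumes "z \<notin> L" "w \<in> L"
  shows "wp (z + w) = wp z"
proof -
  have "(\<lambda>z. wp (z + w) - wp z) constant_on (- L)"
  proof (rule has_field_derivative_0_imp_constant_on)
    fix y assume y: "y \<in> - L"
    have "((\<lambda>z. wp (z + w)) has_field_derivative wp' (y + w)) (at y)"
      using DERIV_shift[of wp "wp' (y + w)" y w] wp_deriv[of "y + w"] y assms by (simp add: L_add_iff)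
    from DERIV_diff[OF this wp_deriv[of y]] y assms
    show "((\<lambda>z. wp (z + w) - wp z) has_field_derivative 0) (at y)"
      by (simp add: wp'_periodic)
  qed (auto simp: connected_Compl_L closed_L open_Compl)
  then obtain c where c: "\<And>y. y \<notin> L \<Longrightarrow> wp (y + w) - wp y = c" unfolding constant_on_def by auto
  \<comment> \<open>The familiar choice \<open>- w / 2\<close> fails when it is a lattice point. The
    pair \<open>z\<close> and \<open>- z - w\<close> avoids \<open>L\<close> and is exchanged with
    shifted arguments by evenness.\<close>
  have "- z - w \<notin> L"
    using assms L_diff_iff[of w "- z"] by simp
  from c[OF this] c[OF assms(1)] wp_even[of z] wp_even[of "z + w"]
  have "wp z - wp (z + w) = c" "wp (z + w) - wp z = c" by simp_all
  then have "2 * (wp (z + w) - wp z) = 0" by (simp add: algebra_simps)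
  then show ?thesis by simp
qed

text \<open>Liouville's theorem for elliptic functions. \<open>F\<close> collects representatives of
  the possible singularities modulo \<open>L\<close>; finite limits there make them removable, and
  periodicity reduces boundedness to one compact rectangle.\<close>

lemma elliptic_constant:
  assumes F: "finite F" and S: "S = {z. \<exists>s\<in>F. z - s \<in> L}"
    and holo: "f holomorphic_on - S"
    and per: "\<And>z w. z \<notin> S \<Longrightarrow> w \<in> L \<Longrightarrow> f (z + w) = f z"
    and lim: "\<And>s. s \<in> F \<Longrightarrow> \<exists>c. (f \<longlongrightarrow> c) (at s)"
  shows "\<exists>C. \<forall>z. z \<notin> S \<longrightarrow> f z = C"
proof -
  have S_add: "z + w \<in> S \<longleftrightarrow> z \<in> S" if "w \<in> L" for z w
  proof -
    have "z + w - s \<in> L \<longleftrightarrow> z - s \<in> L" for s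
      using L_add_iff[OF that, of "z - s"] by (simp add: diff_add_eq)
    then show ?thesis unfolding S by simp
  qed
  have evS: "eventually (\<lambda>z. z \<notin> S) (at z0)" for z0
  proof -
    have "eventually (\<lambda>z. z - s \<notin> L) (at z0)" for s
      using eventually_notin_L[of "z0 - s"] 
      by (simp add: eventually_at_to_0[of _ z0] eventually_at_to_0[of _ "z0 - s"] algebra_simps)
    then have "eventually (\<lambda>z. \<forall>s\<in>F. z - s \<notin> L) (at z0)"
      using F by (intro eventually_ball_finite) auto
    then show ?thesis by eventually_elim (auto simp: S)
  qed
  have openS: "open (- S)"
    unfolding open_closed closed_limpt islimpt_iff_eventually using evS by (simp add: double_complement)
  have limS: "\<exists>c. (f \<longlongrightarrow> c) (at z)" if zS: "z \<in> S" for z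
  proof -
    obtain s where s: "s \<in> F" "z - s \<in> L" using zS S by auto
    obtain c where "(f \<longlongrightarrow> c) (at s)" using lim s by blast
    from LIM_offset[OF this, of "s - z"] have "((\<lambda>x. f (x + (s - z))) \<longlongrightarrow> c) (at z)" by simp
    moreover have "eventually (\<lambda>x. f (x + (s - z)) = f x) (at z)"
      using evS[of z]
    proof eventually_elim
      case (elim x)
      have "s - z \<in> L" using s L_uminus_iff[of "s - z"] by simp
      then show ?case using per elim by simp
    qed
    ultimately show ?thesis using Lim_transform_eventually by blast
  qed
  define g where "g z = (if z \<in> S then Lim (at z) f else f z)" for z
  have gf: "eventually (\<lambda>x. f x = g x) (at z)" for z
    using evS[of z] by eventually_elim (simp add: g_def)
  have glim: "(g \<longlongrightarrow> g z) (at z)" for z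
  proof -
    have "(f \<longlongrightarrow> g z) (at z)"
    proof (cases "z \<in> S")
      case True
      then obtain c where c: "(f \<longlongrightarrow> c) (at z)" using limS by blast
      then have "Lim (at z) f = c" by (intro tendsto_Lim) auto
      then show ?thesis using c True by (simp add: g_def)
    next
      case False
      have "continuous_on (- S) f" using holo by (rule holomorphic_on_imp_continuous_on)
      then have "isCont f z" using False openS by (simp add: continuous_on_eq_continuous_at)
      then show ?thesis using False by (simp add: g_def isCont_def)
    qed
    then show ?thesis using gf Lim_transform_eventually by blast
  qed
  have "g holomorphic_on UNIV"
    unfolding holomorphic_on_def
  proof
    fix z0 :: complex
    obtain r where r: "0 < r" "\<And>z. z \<noteq> z0 \<Longrightarrow> dist z z0 < r \<Longrightarrow> z \<notin> S"
      using evS[of z0] unfolding eventually_at by auto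
    have "g holomorphic_on ball z0 r"
    proof (rule no_isolated_singularity'[where K = "{z0}"])
      show "(g \<longlongrightarrow> g z) (at z within ball z0 r)" if "z \<in> {z0}" for z
        using glim by (rule tendsto_within_subset[where S = UNIV]) simp
      have sub: "ball z0 r - {z0} \<subseteq> - S" using r by (auto simp: dist_commute)
      have "f holomorphic_on ball z0 r - {z0}" using holo sub by (rule holomorphic_on_subset)
      then show "g holomorphic_on ball z0 r - {z0}"
        by (rule holomorphic_transform) (use sub in \<open>auto simp: g_def\<close>)
    qed auto
    then show "g field_differentiable at z0"
      using r by (simp add: holomorphic_on_imp_differentiable_at)
  qed
  moreover have "bounded (range g)"
  proof -
    let ?R = "cbox 0 (Complex (2 * a) (2 * b))"
    have "continuous_on ?R g"
      using glim by (intro continuous_at_imp_continuous_on) (simp add: isCont_def)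
    then have "bounded (g ` ?R)"
      by (intro compact_imp_bounded compact_continuous_image compact_cbox)
    then obtain B where B: "\<And>z. z \<in> ?R \<Longrightarrow> norm (g z) \<le> B" unfolding bounded_iff by blast
    have off: "norm (g z) \<le> B" if "z \<notin> S" for z
    proof -
      obtain w where w: "w \<in> L" "z - w \<in> ?R" using L_reduce by blast
      have "z - w \<notin> S" using S_add[OF w(1), of "z - w"] that by simp
      then show ?thesis using B[OF w(2)] per[of "z - w" w] w that by (simp add: g_def)
    qed
    \<comment> \<open>Periodicity is available only off \<open>S\<close>; the points of
      \<open>S\<close> inherit the bound as limits.\<close>
    have "norm (g z) \<le> B" for z
    proof (rule Lim_norm_ubound[OF _ glim])
      show "eventually (\<lambda>x. norm (g x) \<le> B) (at z)" using evS[of z] by eventually_elim (rule off)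
    qed simp
    then show ?thesis unfolding bounded_iff by auto
  qed
  ultimately have "g constant_on UNIV" by (rule Liouville_theorem)
  then obtain C where "\<And>z. g z = C" unfolding constant_on_def by auto
  then have "f z = C" if "z \<notin> S" for z using that by (metis g_def)
  then show ?thesis by blast
qed

section \<open>Expansion at the origin and the differential equation\<close>

definition "H_deriv_seq i = (if i = 0 then H else (\<lambda>z. (- 1) ^ i * fact (Suc i) * E (i + 2) z))"

text \<open>Successive derivatives of \<open>H\<close>. Index 0 is exceptional because inverse
  squares are summable over the lattice only after the correction by \<open>1 / w^2\<close>.\<close>

lemma H_deriv_seq:
  assumes "z \<notin> L - {0}"
  shows "(H_deriv_seq i has_field_derivative H_deriv_seq (Suc i) z) (at z)"
proof (cases "i = 0")
  case True
  then show ?thesis using H_deriv[OF assms] by (simp add: H_deriv_seq_def numeral_3_eq_3)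
next
  case False
  from DERIV_cmult[OF E_deriv[OF assms, of "i + 2"], of "(- 1) ^ i * fact (Suc i)"] False
  show ?thesis unfolding H_deriv_seq_def by (simp add: algebra_simps)
qed

text \<open>Taylor's formula; odd coefficients vanish by symmetry. The differential equation
  multiplies \<open>H\<close> by at most \<open>1 / z ^ 4\<close> and its derivative by at most
  \<open>1 / z ^ 3\<close>, so errors of this order are negligible for the value at the
  origin.\<close>

lemma H_expansion:
  defines "\<alpha> \<equiv> 3 * E 4 0" and "\<beta> \<equiv> 5 * E 6 0"
  shows "((\<lambda>z. (H z - (\<alpha> * z\<^sup>2 + \<beta> * z ^ 4)) / z ^ 4) \<longlongrightarrow> 0) (at 0)"
    and "((\<lambda>z. (- 2 * E 3 z - (2 * \<alpha> * z + 4 * \<beta> * z ^ 3)) / z ^ 3) \<longlongrightarrow> 0) (at 0)"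
proof -
  define S :: "complex set" where "S = cball 0 (gap / 2)"
  have SL: "z \<notin> L - {0}" if "z \<in> S" for z
    using that gap_le[of z] gap_pos by (auto simp: S_def)
  have "continuous_on S (H_deriv_seq 5)"
    by (intro continuous_at_imp_continuous_on ballI DERIV_isCont[OF H_deriv_seq] SL)
  then have "bounded (H_deriv_seq 5 ` S)"
    by (intro compact_imp_bounded compact_continuous_image) (auto simp: S_def)
  then obtain B where B: "\<And>z. z \<in> S \<Longrightarrow> norm (H_deriv_seq 5 z) \<le> B" unfolding bounded_iff by blast
  have conv: "convex S" and S0: "0 \<in> S" using gap_pos by (auto simp: S_def)
  have H0: "H 0 = 0" by (simp add: H_def)
  have odd0: "E 3 0 = 0" "E 5 0 = 0" by (simp_all add: E_odd_0)
  have seqs: "H_deriv_seq 0 = H" "H_deriv_seq (Suc 0) = (\<lambda>z. - 2 * E 3 z)" 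
    by (simp_all add: H_deriv_seq_def fun_eq_iff numeral_3_eq_3)
  have seq0: "H_deriv_seq 0 0 = 0" "H_deriv_seq (Suc 0) 0 = 0" "H_deriv_seq 2 0 = 6 * E 4 0"
      "H_deriv_seq 3 0 = 0" "H_deriv_seq 4 0 = 120 * E 6 0"
    using odd0 by (simp_all add: seqs H0) (simp_all add: H_deriv_seq_def fact_numeral)
  have evS: "eventually (\<lambda>z. z \<in> S \<and> z \<noteq> 0) (at 0)"
    unfolding eventually_at S_def using gap_pos by (intro exI[of _ "gap / 2"]) auto
  have T1: "norm (H z - (\<alpha> * z\<^sup>2 + \<beta> * z ^ 4)) \<le> B * norm z ^ 5 / 24" if "z \<in> S" for z
  proof -
    have "norm (H_deriv_seq 0 z - (\<Sum>i\<le>4. H_deriv_seq i 0 * (z - 0) ^ i / fact i)) \<le> B * norm (z - 0) ^ Suc 4 / fact 4"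
    proof (rule complex_Taylor[OF conv _ _ S0 that])
      show "(H_deriv_seq i has_field_derivative H_deriv_seq (Suc i) x) (at x within S)" if "x \<in> S" for i x
        using H_deriv_seq[OF SL[OF that]] by (rule has_field_derivative_at_within)
      show "norm (H_deriv_seq (Suc 4) x) \<le> B" if "x \<in> S" for x using B[OF that] by simp
    qed
    moreover have "(\<Sum>i\<le>4. H_deriv_seq i 0 * (z - 0) ^ i / fact i) = \<alpha> * z\<^sup>2 + \<beta> * z ^ 4"
    proof -
      have "{..4::nat} = {0, Suc 0, 2, 3, 4}" by auto
      then show ?thesis by (simp add: seq0 \<alpha>_def \<beta>_def fact_numeral del: One_nat_def)
    qed
    ultimately show ?thesis by (simp add: seqs fact_numeral)
  qed
  have T2: "norm (- 2 * E 3 z - (2 * \<alpha> * z + 4 * \<beta> * z ^ 3)) \<le> B * norm z ^ 4 / 6" if "z \<in> S" for z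
  proof -
    have "norm (H_deriv_seq (Suc 0) z - (\<Sum>i\<le>3. H_deriv_seq (Suc i) 0 * (z - 0) ^ i / fact i)) \<le> B * norm (z - 0) ^ Suc 3 / fact 3"
    proof (rule complex_Taylor[OF conv _ _ S0 that, where f = "\<lambda>i. H_deriv_seq (Suc i)"])
      show "(H_deriv_seq (Suc i) has_field_derivative H_deriv_seq (Suc (Suc i)) x) (at x within S)" if "x \<in> S" for i x
        using H_deriv_seq[OF SL[OF that]] by (rule has_field_derivative_at_within)
      show "norm (H_deriv_seq (Suc (Suc 3)) x) \<le> B" if "x \<in> S" for x using B[OF that] by (simp add: eval_nat_numeral)
    qed
    moreover have "(\<Sum>i\<le>3. H_deriv_seq (Suc i) 0 * (z - 0) ^ i / fact i) = 2 * \<alpha> * z + 4 * \<beta> * z ^ 3"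
    proof -
      have "{..3::nat} = {0, Suc 0, 2, 3}" by auto
      moreover have "H_deriv_seq (Suc (Suc 0)) 0 = 6 * E 4 0" using seq0(3) by (simp add: numeral_2_eq_2)
      ultimately show ?thesis by (simp add: seq0 \<alpha>_def \<beta>_def fact_numeral del: One_nat_def)
    qed
    ultimately show ?thesis by (simp add: seqs fact_numeral)
  qed
  have z0: "((\<lambda>z::complex. norm z) \<longlongrightarrow> 0) (at 0)" using tendsto_norm_zero[OF tendsto_ident_at] .
  have l1: "((\<lambda>z::complex. B / 24 * norm z) \<longlongrightarrow> 0) (at 0)"
    by (rule tendsto_mult_right_zero[OF z0])
  have l2: "((\<lambda>z::complex. B / 6 * norm z) \<longlongrightarrow> 0) (at 0)"
    by (rule tendsto_mult_right_zero[OF z0])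
  show "((\<lambda>z. (H z - (\<alpha> * z\<^sup>2 + \<beta> * z ^ 4)) / z ^ 4) \<longlongrightarrow> 0) (at 0)"
  proof (rule Lim_null_comparison[OF eventually_mono[OF evS] l1])
    fix z :: complex assume z: "z \<in> S \<and> z \<noteq> 0"
    have "norm z ^ 5 = norm z * norm z ^ 4" by (simp add: eval_nat_numeral)
    then have "norm (H z - (\<alpha> * z\<^sup>2 + \<beta> * z ^ 4)) \<le> B / 24 * norm z * norm z ^ 4" using T1[of z] z by simp
    then show "norm ((H z - (\<alpha> * z\<^sup>2 + \<beta> * z ^ 4)) / z ^ 4) \<le> B / 24 * norm z"
      using z by (simp add: norm_divide norm_power pos_divide_le_eq)
  qed
  show "((\<lambda>z. (- 2 * E 3 z - (2 * \<alpha> * z + 4 * \<beta> * z ^ 3)) / z ^ 3) \<longlongrightarrow> 0) (at 0)"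
  proof (rule Lim_null_comparison[OF eventually_mono[OF evS] l2])
    fix z :: complex assume z: "z \<in> S \<and> z \<noteq> 0"
    have "norm z ^ 4 = norm z * norm z ^ 3" by (simp add: eval_nat_numeral)
    then have "norm (- 2 * E 3 z - (2 * \<alpha> * z + 4 * \<beta> * z ^ 3)) \<le> B / 6 * norm z * norm z ^ 3" using T2[of z] z by simp
    then show "norm ((- 2 * E 3 z - (2 * \<alpha> * z + 4 * \<beta> * z ^ 3)) / z ^ 3) \<le> B / 6 * norm z"
      using z by (simp add: norm_divide norm_power pos_divide_le_eq)
  qed
qed

lemma wp_holomorphic: "wp holomorphic_on - L"
  unfolding holomorphic_on_def using wp_deriv by (meson ComplD field_differentiable_at_within field_differentiable_def)

lemma wp'_holomorphic: "wp' holomorphic_on - L"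
proof -
  have "E 3 field_differentiable at z" if "z \<notin> L" for z
    using E_deriv[of z 3] that unfolding field_differentiable_def by auto
  then have "E 3 holomorphic_on - L"
    unfolding holomorphic_on_def by (auto intro: field_differentiable_at_within)
  then show ?thesis unfolding wp'_def[abs_def] by (intro holomorphic_intros) auto
qed

lemma H_at_0: "H 0 = 0" "(H \<longlongrightarrow> 0) (at 0)" "((\<lambda>z. H z / z) \<longlongrightarrow> 0) (at 0)"
proof -
  show H0: "H 0 = 0" by (simp add: H_def)
  have d: "(H has_field_derivative 0) (at 0)" using H_deriv[of 0] by (simp add: E_odd_0)
  show "((\<lambda>z. H z / z) \<longlongrightarrow> 0) (at 0)" using d by (simp add: has_field_derivative_iff H0)
  show "(H \<longlongrightarrow> 0) (at 0)" using DERIV_isCont[OF d] by (simp add: isCont_def H0)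
qed

lemma g2_eq: "wp_g2 L = 60 * E 4 0"
  by (simp add: wp_g2_def E_def)

lemma g3_eq: "wp_g3 L = 140 * E 6 0"
  by (simp add: wp_g3_def E_def)

text \<open>The difference of the two sides is elliptic, and the choice of the invariants cancels
  its principal part and its constant term at the origin. It is therefore constant with limit
  0.\<close>

lemma wp_ode:
  assumes "z \<notin> L"
  shows "(wp' z)\<^sup>2 = 4 * wp z ^ 3 - wp_g2 L * wp z - wp_g3 L"
proof -
  define f where "f z = (wp' z)\<^sup>2 - 4 * wp z ^ 3 + wp_g2 L * wp z + wp_g3 L" for z
  define \<alpha> where "\<alpha> = 3 * E 4 0"
  define \<beta> where "\<beta> = 5 * E 6 0"
  have g: "wp_g2 L = 20 * \<alpha>" "wp_g3 L = 28 * \<beta>" by (simp_all add: g2_eq g3_eq \<alpha>_def \<beta>_def)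
  let ?R = "\<lambda>z. (H z - (\<alpha> * z\<^sup>2 + \<beta> * z ^ 4)) / z ^ 4"
  let ?R' = "\<lambda>z. (- 2 * E 3 z - (2 * \<alpha> * z + 4 * \<beta> * z ^ 3)) / z ^ 3"
  have R: "(?R \<longlongrightarrow> 0) (at 0)" "(?R' \<longlongrightarrow> 0) (at 0)"
    using H_expansion unfolding \<alpha>_def \<beta>_def by auto
  have E3: "(E 3 \<longlongrightarrow> 0) (at 0)"
    using DERIV_isCont[OF E_deriv[of 0 3]] by (simp add: isCont_def E_odd_0)
  \<comment> \<open>All poles are collected into the two Taylor remainders and \<open>h / z\<close>,
    each of which tends to 0 when \<open>h\<close> and \<open>k\<close> are \<open>H\<close> and its
    derivative.\<close>
  have id: "(- 2 / z ^ 3 + k)\<^sup>2 - 4 * (1 / z\<^sup>2 + h) ^ 3 + 20 * \<alpha> * (1 / z\<^sup>2 + h) + 28 * \<beta> =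
      - 4 * ((k - (2 * \<alpha> * z + 4 * \<beta> * z ^ 3)) / z ^ 3) - 12 * ((h - (\<alpha> * z\<^sup>2 + \<beta> * z ^ 4)) / z ^ 4)
        + k\<^sup>2 - 12 * (h / z)\<^sup>2 - 4 * h ^ 3 + 20 * \<alpha> * h" if "z \<noteq> 0" for z h k :: complex
  proof -
    define i where "i = 1 / z"
    have iz: "i * z = 1" using that by (simp add: i_def)
    have inv: "c / z ^ n = c * i ^ n" for c n by (simp add: i_def power_divide)
    have inv1: "c / z = c * i" for c by (simp add: i_def)
    have "(- 2 * i ^ 3 + k)\<^sup>2 - 4 * (1 * i\<^sup>2 + h) ^ 3 + 20 * \<alpha> * (1 * i\<^sup>2 + h) + 28 * \<beta> =
      - 4 * ((k - (2 * \<alpha> * z + 4 * \<beta> * z ^ 3)) * i ^ 3) - 12 * ((h - (\<alpha> * z\<^sup>2 + \<beta> * z ^ 4)) * i ^ 4)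
        + k\<^sup>2 - 12 * (h * i)\<^sup>2 - 4 * h ^ 3 + 20 * \<alpha> * h"
      using iz by algebra
    then show ?thesis unfolding inv inv1 .
  qed
  have feq: "f z = - 4 * ?R' z - 12 * ?R z + (- 2 * E 3 z)\<^sup>2 - 12 * (H z / z)\<^sup>2 - 4 * H z ^ 3 + 20 * \<alpha> * H z"
    if "z \<noteq> 0" for z
    using id[OF that, of "- 2 * E 3 z" "H z"] unfolding f_def wp_def wp'_def g by simp
  have "((\<lambda>z. - 4 * ?R' z - 12 * ?R z + (- 2 * E 3 z)\<^sup>2 - 12 * (H z / z)\<^sup>2 - 4 * H z ^ 3 + 20 * \<alpha> * H z)
      \<longlongrightarrow> - 4 * 0 - 12 * 0 + (- 2 * 0)\<^sup>2 - 12 * 0\<^sup>2 - 4 * 0 ^ 3 + 20 * \<alpha> * 0) (at 0)"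
    by (intro tendsto_intros R E3 H_at_0)
  then have "((\<lambda>z. - 4 * ?R' z - 12 * ?R z + (- 2 * E 3 z)\<^sup>2 - 12 * (H z / z)\<^sup>2 - 4 * H z ^ 3 + 20 * \<alpha> * H z)
      \<longlongrightarrow> 0) (at 0)" by simp
  then have f0: "(f \<longlongrightarrow> 0) (at 0)"
    by (rule Lim_transform_eventually) (simp add: feq eventually_at_filter)
  have "\<exists>C. \<forall>z. z \<notin> L \<longrightarrow> f z = C"
  proof (rule elliptic_constant[where F = "{0}"])
    show "f holomorphic_on - L"
      unfolding f_def[abs_def] by (intro holomorphic_intros wp_holomorphic wp'_holomorphic)
    show "f (z + w) = f z" if "z \<notin> L" "w \<in> L" for z w
      using that by (simp add: f_def wp_periodic wp'_periodic)
    show "\<exists>c. (f \<longlongrightarrow> c) (at s)" if "s \<in> {0}" for s using that f0 by blast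
  qed auto
  then obtain C where C: "\<And>z. z \<notin> L \<Longrightarrow> f z = C" by blast
  have "((\<lambda>_. C) \<longlongrightarrow> 0) (at (0::complex))"
  proof (rule Lim_transform_eventually[OF f0])
    show "eventually (\<lambda>z. f z = C) (at 0)"
      using eventually_notin_L by eventually_elim (rule C)
  qed
  then have "C = 0" by (simp add: tendsto_const_iff)
  then show ?thesis using C[OF assms] by (simp add: f_def algebra_simps)
qed

section \<open>Critical points and critical values\<close>

lemma eventually_wp_neq: "eventually (\<lambda>z. wp z \<noteq> e) (at 0)"
proof -
  have "((\<lambda>z. 1 + (H z - e) * z\<^sup>2) \<longlongrightarrow> 1 + (0 - e) * 0\<^sup>2) (at 0)"
    by (intro tendsto_intros H_at_0)
  then have "eventually (\<lambda>z. 1 + (H z - e) * z\<^sup>2 \<noteq> 0) (at 0)"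
    by (rule tendsto_imp_eventually_ne) simp
  moreover have "eventually (\<lambda>z::complex. z \<noteq> 0) (at 0)" by (simp add: eventually_at_filter)
  ultimately show ?thesis
  proof eventually_elim
    case (elim z)
    then show ?case by (auto simp: wp_def field_simps)
  qed
qed

lemma wp_product_limit:
  assumes p: "p \<notin> L" "wp' p = 0"
  shows "\<exists>l. ((\<lambda>y. (wp y - wp p) * (wp (y + p) - wp p)) \<longlongrightarrow> l) (at 0)"
proof -
  define U where "U = {y. y + p \<notin> L}"
  have U: "open U"
  proof -
    have "U = (\<lambda>y. y + p) -` (- L)" by (auto simp: U_def)
    then show ?thesis using closed_L by (simp only:) (intro continuous_open_vimage continuous_intros, auto)
  qed
  have U0: "0 \<in> U" using p by (simp add: U_def)
  define D where "D y = wp (y + p) - wp p" for y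
  have dD: "(D has_field_derivative wp' (y + p)) (at y)" if "y \<in> U" for y
  proof -
    have "((\<lambda>y. wp (y + p)) has_field_derivative wp' (y + p)) (at y)"
      using DERIV_shift[of wp "wp' (y + p)" y p] wp_deriv[of "y + p"] that by (simp add: U_def)
    from DERIV_diff[OF this DERIV_const] show ?thesis unfolding D_def[abs_def] by simp
  qed
  then have D: "D holomorphic_on U"
    unfolding holomorphic_on_def by (meson field_differentiable_at_within field_differentiable_def)
  \<comment> \<open>Each division by \<open>z\<close> is a removable singularity as long as the
    value at 0 vanishes. It does so twice, since \<open>p\<close> is critical, giving
    \<open>D y = y^2 * D2 y\<close> and hence cancellation of the double pole.\<close>
  define D1 where "D1 z = (if z = 0 then deriv D 0 else (D z - D 0) / (z - 0))" for z
  define D2 where "D2 z = (if z = 0 then deriv D1 0 else (D1 z - D1 0) / (z - 0))" for z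
  have D1: "D1 holomorphic_on U" unfolding D1_def[abs_def] by (rule pole_lemma_open[OF D U])
  have D2: "D2 holomorphic_on U" unfolding D2_def[abs_def] by (rule pole_lemma_open[OF D1 U])
  have "D1 0 = 0" using DERIV_imp_deriv[OF dD[OF U0]] p by (simp add: D1_def)
  moreover have "D 0 = 0" by (simp add: D_def)
  ultimately have Dy: "D y = y\<^sup>2 * D2 y" if "y \<noteq> 0" for y
    using that by (simp add: D2_def D1_def power2_eq_square)
  have "isCont D2 0"
    using holomorphic_on_imp_continuous_on[OF D2] U U0 by (simp add: continuous_on_eq_continuous_at)
  then have "(D2 \<longlongrightarrow> D2 0) (at 0)" by (simp add: isCont_def)
  then have "((\<lambda>y. (1 + (H y - wp p) * y\<^sup>2) * D2 y) \<longlongrightarrow> (1 + (0 - wp p) * 0\<^sup>2) * D2 0) (at 0)"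
    by (intro tendsto_intros H_at_0)
  then have "((\<lambda>y. (wp y - wp p) * (wp (y + p) - wp p)) \<longlongrightarrow> (1 + (0 - wp p) * 0\<^sup>2) * D2 0) (at 0)"
  proof (rule Lim_transform_eventually)
    have "(1 + (H y - wp p) * y\<^sup>2) * D2 y = (wp y - wp p) * (wp (y + p) - wp p)" if "y \<noteq> 0" for y
      using Dy[OF that] that by (simp add: D_def wp_def[of y] field_simps)
    then show "eventually (\<lambda>y. (1 + (H y - wp p) * y\<^sup>2) * D2 y = (wp y - wp p) * (wp (y + p) - wp p)) (at 0)"
      by (simp add: eventually_at_filter)
  qed
  then show ?thesis by blast
qed

text \<open>At a zero \<open>p\<close> of \<open>wp'\<close> the poles of \<open>(wp z - wp p) (wp (z - p) - wp p)\<close> cancel against double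
  zeros, so this product is a nonzero constant.\<close>

lemma wp_eq_critical_value:
  assumes p: "p \<notin> L" "wp' p = 0" and z: "z \<notin> L" "wp z = wp p"
  shows "z - p \<in> L"
proof (rule ccontr)
  assume zp: "z - p \<notin> L"
  define S where "S = {z. \<exists>s\<in>{0, p}. z - s \<in> L}"
  define f where "f z = (wp z - wp p) * (wp (z - p) - wp p)" for z
  have S: "y \<notin> S \<longleftrightarrow> y \<notin> L \<and> y - p \<notin> L" for y by (auto simp: S_def)
  have "\<exists>C. \<forall>z. z \<notin> S \<longrightarrow> f z = C"
  proof (rule elliptic_constant[where F = "{0, p}"])
    have "(\<lambda>z. z - p) holomorphic_on - S" by (intro holomorphic_intros)
    moreover have "(\<lambda>z. z - p) ` (- S) \<subseteq> - L" using S by auto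
    ultimately have "(\<lambda>z. wp (z - p)) holomorphic_on - S"
      using holomorphic_on_compose_gen[of "\<lambda>z. z - p" "- S" wp "- L"] wp_holomorphic
      by (simp add: o_def)
    moreover have "wp holomorphic_on - S"
      using wp_holomorphic by (rule holomorphic_on_subset) (use S in blast)
    ultimately show "f holomorphic_on - S" unfolding f_def[abs_def] by (intro holomorphic_intros)
    show "f (y + w) = f y" if "y \<notin> S" "w \<in> L" for y w
    proof -
      have "wp (y + w - p) = wp (y - p)"
        using wp_periodic[of "y - p" w] that S by (simp add: diff_add_eq)
      then show ?thesis using that S by (simp add: f_def wp_periodic)
    qed
    fix s assume "s \<in> {0, p}"
    then show "\<exists>c. (f \<longlongrightarrow> c) (at s)"
    proof
      assume "s = 0"
      moreover have "- p \<notin> L" "wp' (- p) = 0" using p by (auto simp: wp'_odd)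
      from wp_product_limit[OF this] have "\<exists>l. (f \<longlongrightarrow> l) (at 0)"
        by (simp add: wp_even f_def[abs_def])
      ultimately show ?thesis by simp
    next
      assume "s \<in> {p}"
      moreover from wp_product_limit[OF p] obtain l
        where "((\<lambda>y. (wp y - wp p) * (wp (y + p) - wp p)) \<longlongrightarrow> l) (at 0)" by blast
      then have "((\<lambda>h. f (p + h)) \<longlongrightarrow> l) (at 0)" by (simp add: f_def mult.commute add.commute)
      then have "(f \<longlongrightarrow> l) (at p)" by (rule LIM_offset_zero_cancel)
      ultimately show ?thesis by blast
    qed
  qed (auto simp: S_def)
  then obtain C where C: "\<And>y. y \<notin> S \<Longrightarrow> f y = C" by blast
  \<comment> \<open>A second solution outside \<open>p + L\<close> forces the constant to be 0. Near
    the origin the first factor is nonzero, so the second must vanish throughout a punctured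
    neighbourhood, and the identity theorem makes \<open>wp\<close> constant, against its
    pole.\<close>
  have "C = 0" using C[of z] S zp z by (simp add: f_def)
  have evS: "eventually (\<lambda>y. y - p \<notin> L) (at 0)"
    using eventually_notin_L[of "- p"]
    by (simp add: eventually_at_to_0[of _ "- p"] algebra_simps)
  have "eventually (\<lambda>y. y - p \<notin> L \<and> wp (y - p) = wp p) (at 0)"
    using eventually_notin_L[of 0] evS eventually_wp_neq[of "wp p"]
  proof eventually_elim
    case (elim y)
    then show ?case using C[of y] S \<open>C = 0\<close> by (simp add: f_def)
  qed
  then have ev: "eventually (\<lambda>y. y \<in> {y. y \<notin> L \<and> wp y = wp p}) (at (- p))"
    by (simp add: eventually_at_to_0[of _ "- p"] algebra_simps)
  have limpt: "- p islimpt {y. y \<notin> L \<and> wp y = wp p}"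
    unfolding islimpt_iff_eventually
  proof
    assume "eventually (\<lambda>y. y \<notin> {y. y \<notin> L \<and> wp y = wp p}) (at (- p))"
    with ev have "eventually (\<lambda>y. False) (at (- p))" by eventually_elim blast
    then show False by simp
  qed
  have const: "wp y - wp p = 0" if "y \<in> - L" for y
    by (rule analytic_continuation[where f = "\<lambda>y. wp y - wp p" and S = "- L", OF _ _ _ _ _ limpt _ that])
       (use p closed_L connected_Compl_L wp_holomorphic in \<open>auto intro!: holomorphic_intros\<close>)
  have "eventually (\<lambda>y. False) (at (0::complex))"
    using eventually_notin_L[of 0] eventually_wp_neq[of "wp p"]
    by eventually_elim (use const in force)
  then show False by simp
qed

text \<open>By evenness a critical point \<open>p\<close> shares its value with \<open>- p\<close>,
  so the two agree modulo \<open>L\<close>; conversely an odd periodic function vanishes at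
  half-periods.\<close>

lemma wp'_eq_0_iff:
  assumes "p \<notin> L"
  shows "wp' p = 0 \<longleftrightarrow> 2 * p \<in> L"
proof
  assume "wp' p = 0"
  from wp_eq_critical_value[OF assms this, of "- p"] assms
  have "- p - p \<in> L" by (simp add: wp_even)
  then show "2 * p \<in> L" using L_uminus_iff[of "2 * p"] by simp
next
  assume "2 * p \<in> L"
  then have "wp' (- p + 2 * p) = wp' (- p)" using assms by (intro wp'_periodic) auto
  then have "wp' p = - wp' p" by (simp add: wp'_odd)
  then show "wp' p = 0" by simp
qed

lemma half_periods:
  "complex_of_real a \<notin> L" "Complex 0 b \<notin> L" "Complex a b \<notin> L"
  "2 * complex_of_real a \<in> L" "2 * Complex 0 b \<in> L" "2 * Complex a b \<in> L"
  "complex_of_real a - Complex 0 b \<notin> L" "complex_of_real a - Complex a b \<notin> L" "Complex 0 b - Complex a b \<notin> L"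
proof -
  have ne: "c \<noteq> 2 * c * of_int m" "- c \<noteq> 2 * c * of_int m" if "0 < c" for c :: real and m
  proof -
    have "1 \<noteq> 2 * m" "- 1 \<noteq> 2 * m" by presburger+
    then have "1 \<noteq> 2 * real_of_int m" "- 1 \<noteq> 2 * real_of_int m" by linarith+
    then show "c \<noteq> 2 * c * of_int m" "- c \<noteq> 2 * c * of_int m"
      using that by (metis mult.assoc mult.left_commute mult_cancel_left1 less_irrefl, 
        metis mult.assoc mult.left_commute mult_cancel_left mult_minus1_right less_irrefl)
  qed
  show "complex_of_real a \<notin> L" "Complex 0 b \<notin> L" "Complex a b \<notin> L"
    "complex_of_real a - Complex 0 b \<notin> L" "complex_of_real a - Complex a b \<notin> L" "Complex 0 b - Complex a b \<notin> L"
    unfolding L_iff using ne[OF a] ne[OF b] by (auto simp: complex_eq_iff)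
  show "2 * complex_of_real a \<in> L" unfolding L_iff
    by (rule exI[of _ 1], rule exI[of _ 0]) (simp add: complex_eq_iff)
  show "2 * Complex 0 b \<in> L" unfolding L_iff
    by (rule exI[of _ 0], rule exI[of _ 1]) (simp add: complex_eq_iff)
  show "2 * Complex a b \<in> L" unfolding L_iff
    by (rule exI[of _ 1], rule exI[of _ 1]) (simp add: complex_eq_iff)
qed

section \<open>Real invariants and positive discriminant\<close>

definition G2 :: real where "G2 = Re (wp_g2 L)"
definition G3 :: real where "G3 = Re (wp_g3 L)"

lemma g_real: "wp_g2 L = of_real G2" "wp_g3 L = of_real G3"
proof -
  have "cnj (wp_g2 L) = wp_g2 L" "cnj (wp_g3 L) = wp_g3 L"
    using E_cnj[of 4 0] E_cnj[of 6 0] by (simp_all add: g2_eq g3_eq)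
  then show "wp_g2 L = of_real G2" "wp_g3 L = of_real G3"
    unfolding G2_def G3_def by (simp_all add: complex_eq_iff)
qed

text \<open>The roots are the values of \<open>wp\<close> at the three half-periods. Conjugation
  moves a half-period, up to sign, by a lattice vector, so the values are real; they differ because
  a critical value is taken in one class modulo \<open>L\<close> only.\<close>

lemma half_period_roots:
  obtains x y z where "4 * x ^ 3 - G2 * x - G3 = 0" "4 * y ^ 3 - G2 * y - G3 = 0" "4 * z ^ 3 - G2 * z - G3 = 0"
    "x \<noteq> y" "y \<noteq> z" "x \<noteq> (z::real)"
proof -
  have realI: "wp p = of_real (Re (wp p))" if "p \<notin> L" "cnj p - p \<in> L \<or> cnj p + p \<in> L" for p
  proof -
    have "wp (cnj p) = wp p"
      using wp_periodic[of p "cnj p - p"] wp_periodic[of "- p" "cnj p + p"] that by (auto simp: wp_even)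
    then show ?thesis by (simp add: wp_cnj complex_eq_iff)
  qed
  have r: "wp (complex_of_real a) = of_real (Re (wp (complex_of_real a)))"
    "wp (Complex 0 b) = of_real (Re (wp (Complex 0 b)))"
    "wp (Complex a b) = of_real (Re (wp (Complex a b)))"
  proof -
    have "cnj (Complex 0 b) + Complex 0 b = 0" "cnj (Complex a b) + Complex a b = 2 * of_real a"
      by (auto simp: complex_eq_iff)
    then show "wp (complex_of_real a) = of_real (Re (wp (complex_of_real a)))"
      "wp (Complex 0 b) = of_real (Re (wp (Complex 0 b)))"
      "wp (Complex a b) = of_real (Re (wp (Complex a b)))"
      using half_periods by (intro realI; simp)+
  qed
  have root: "4 * Re (wp p) ^ 3 - G2 * Re (wp p) - G3 = 0"
    if "p \<notin> L" "2 * p \<in> L" and re: "wp p = of_real (Re (wp p))" for p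
  proof -
    have "0 = 4 * wp p ^ 3 - wp_g2 L * wp p - wp_g3 L"
      using wp_ode[OF that(1)] wp'_eq_0_iff[OF that(1)] that(2) by simp
    also have "\<dots> = of_real (4 * Re (wp p) ^ 3 - G2 * Re (wp p) - G3)"
      unfolding g_real by (subst (1 2) re) simp
    finally show ?thesis by (metis of_real_eq_0_iff)
  qed
  have ne: "Re (wp p) \<noteq> Re (wp p')" if "p \<notin> L" "2 * p \<in> L" "p' \<notin> L" "p' - p \<notin> L"
    "wp p = of_real (Re (wp p))" "wp p' = of_real (Re (wp p'))" for p p'
    using wp_eq_critical_value[of p p'] wp'_eq_0_iff[of p] that by metis
  show ?thesis
    by (rule that[OF root root root ne ne ne,
          of "Complex a b" "Complex 0 b" "complex_of_real a"])
       (use half_periods r in auto)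
qed

lemma G2_pos: "0 < G2" and discriminant_pos: "27 * G3\<^sup>2 < G2 ^ 3"
  using half_period_roots cubic_three_real_roots by metis+

section \<open>Motion along the real axis\<close>

definition X :: "real \<Rightarrow> real" where "X u = Re (wp (of_real u))"

lemma of_real_notin_L:
  assumes "0 < u" "u < 2 * a"
  shows "complex_of_real u \<notin> L"
proof
  assume "complex_of_real u \<in> L"
  then obtain m where m: "u = 2 * a * of_int m" unfolding L_iff by (auto simp: complex_eq_iff)
  then have "0 < real_of_int m" "real_of_int m < 1"
    using assms a by (auto simp: zero_less_mult_iff mult_less_cancel_left1)
  then show False by simp
qed

lemma X_deriv:
  assumes "0 < u" "u < 2 * a"
  shows "(X has_real_derivative Re (wp' (of_real u))) (at u)"
  unfolding X_def[abs_def]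
  by (intro has_field_derivative_Re has_vector_derivative_real_field wp_deriv of_real_notin_L assms)

lemma X_ode:
  assumes "0 < u" "u < 2 * a"
  shows "(Re (wp' (of_real u)))\<^sup>2 = 4 * X u ^ 3 - G2 * X u - G3"
proof -
  have "cnj (wp (of_real u)) = wp (of_real u)" using wp_cnj[of "of_real u"] by simp
  then have w: "wp (of_real u) = of_real (X u)" by (simp add: X_def complex_eq_iff)
  have "cnj (wp' (of_real u)) = wp' (of_real u)" using wp'_cnj[of "of_real u"] by simp
  then have w': "wp' (of_real u) = of_real (Re (wp' (of_real u)))" by (simp add: complex_eq_iff)
  have "complex_of_real ((Re (wp' (of_real u)))\<^sup>2) = (wp' (of_real u))\<^sup>2" by (subst (2) w') simp
  also have "\<dots> = of_real (4 * X u ^ 3 - G2 * X u - G3)"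
    unfolding wp_ode[OF of_real_notin_L[OF assms]] g_real w by simp
  finally show ?thesis by (simp only: of_real_eq_iff)
qed

lemma X_at_top: "filterlim X at_top (at_right 0)"
proof -
  have "filterlim complex_of_real (at 0) (at_right 0)"
    unfolding filterlim_at by (auto intro!: tendsto_eq_intros simp: eventually_at_filter)
  from filterlim_compose[OF H_at_0(2) this]
  have "((\<lambda>u. Re (H (of_real u))) \<longlongrightarrow> Re 0) (at_right 0)" by (rule tendsto_Re)
  moreover have "filterlim (\<lambda>u::real. 1 / u\<^sup>2) at_top (at_right 0)" by real_asymp
  ultimately have "filterlim (\<lambda>u. Re (H (of_real u)) + 1 / u\<^sup>2) at_top (at_right 0)"
    by (rule filterlim_tendsto_add_at_top)
  moreover have "X = (\<lambda>u. Re (H (of_real u)) + 1 / u\<^sup>2)"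
    by (simp add: fun_eq_iff X_def wp_def Re_divide_of_real flip: of_real_power)
  ultimately show ?thesis by simp
qed

lemma X_deriv_nz:
  assumes "0 < u" "u < a"
  shows "Re (wp' (of_real u)) \<noteq> 0"
proof
  assume z: "Re (wp' (of_real u)) = 0"
  have "cnj (wp' (of_real u)) = wp' (of_real u)" using wp'_cnj[of "of_real u"] by simp
  then have "wp' (of_real u) = 0" using z by (simp add: complex_eq_iff)
  then have "complex_of_real (2 * u) \<in> L"
    using wp'_eq_0_iff of_real_notin_L[of u] assms by simp
  then show False using of_real_notin_L[of "2 * u"] assms by simp
qed

text \<open>The derivative has no zero before \<open>a\<close> and so keeps its sign. A positive
  sign would bound \<open>X\<close> near 0 by a later value, although it tends to infinity
  there.\<close>

lemma X_deriv_neg: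
  assumes "0 < u" "u < a"
  shows "Re (wp' (of_real u)) < 0"
proof (rule ccontr)
  assume "\<not> Re (wp' (of_real u)) < 0"
  then have pos: "0 < Re (wp' (of_real u))" using X_deriv_nz[OF assms] by simp
  have pos': "0 < Re (wp' (of_real v))" if "0 < v" "v \<le> u" for v
  proof (rule ccontr)
    assume "\<not> 0 < Re (wp' (of_real v))"
    moreover have "continuous_on {v..u} (\<lambda>v. Re (wp' (of_real v)))"
    proof (intro continuous_intros continuous_on_compose2[OF holomorphic_on_imp_continuous_on[OF wp'_holomorphic]])
      show "complex_of_real ` {v..u} \<subseteq> - L" using of_real_notin_L that assms a by auto
    qed
    ultimately have "\<exists>y\<ge>v. y \<le> u \<and> Re (wp' (of_real y)) = 0"
      using pos that by (intro IVT') auto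
    then show False using X_deriv_nz that assms by (metis order.strict_trans2 order.strict_trans1)
  qed
  have mono: "X v \<le> X u" if "0 < v" "v \<le> u" for v
  proof (rule DERIV_nonneg_imp_nondecreasing[OF that(2)])
    fix x assume "v \<le> x" "x \<le> u"
    then show "\<exists>y. DERIV X x :> y \<and> 0 \<le> y"
      using X_deriv[of x] pos'[of x] that assms a by (intro exI[of _ "Re (wp' (of_real x))"]) auto
  qed
  have "eventually (\<lambda>v. X u + 1 \<le> X v) (at_right 0)" using X_at_top by (simp add: filterlim_at_top)
  moreover have "eventually (\<lambda>v. v \<in> {0<..<u}) (at_right 0)" using eventually_at_right_real[OF assms(1)] .
  ultimately have "eventually (\<lambda>v. False) (at_right (0::real))"
    by eventually_elim (use mono in force)
  then show False by (simp add: trivial_limit_at_right_real)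
qed

lemma X_motion:
  assumes "0 < u" "u < a"
  shows "(X has_real_derivative - sqrt (4 * X u ^ 3 - G2 * X u - G3)) (at u)"
    and "0 < 4 * X u ^ 3 - G2 * X u - G3"
proof -
  have u: "u < 2 * a" using assms by simp
  have "sqrt (4 * X u ^ 3 - G2 * X u - G3) = - Re (wp' (of_real u))"
    unfolding X_ode[OF assms(1) u, symmetric] real_sqrt_abs using X_deriv_neg[OF assms] by simp
  then show "(X has_real_derivative - sqrt (4 * X u ^ 3 - G2 * X u - G3)) (at u)"
    using X_deriv[OF assms(1) u] by simp
  show "0 < 4 * X u ^ 3 - G2 * X u - G3"
    unfolding X_ode[OF assms(1) u, symmetric] using X_deriv_neg[OF assms] by simp
qed

lemma X_end: "4 * X a ^ 3 - G2 * X a - G3 = 0"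
proof -
  have "wp' (of_real a) = 0" using wp'_eq_0_iff half_periods(1,4) by blast
  then show ?thesis using X_ode[of a] a by simp
qed

lemma X_cont: "continuous_on {0<..a} X"
  by (intro continuous_at_imp_continuous_on ballI DERIV_isCont[OF X_deriv]) (use a in auto)

end

section \<open>The half-periods\<close>

lemma lattice_scale: "(*) c ` lattice w1 w2 = lattice (c * w1) (c * w2)"
proof -
  have "lattice v1 v2 = (\<lambda>(m, n). of_int m * v1 + of_int n * v2) ` UNIV" for v1 v2
    by (auto simp: lattice_def image_iff)
  then show ?thesis by (simp add: image_image split_def algebra_simps)
qed

lemma infsum_power_scale:
  fixes c :: complex
  assumes "c \<noteq> 0"
  shows "(\<Sum>\<^sub>\<infinity>w\<in>(*) c ` A - {0}. 1 / w ^ k) = (\<Sum>\<^sub>\<infinity>w\<in>A - {0}. 1 / w ^ k) / c ^ k"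
proof -
  have "(\<Sum>\<^sub>\<infinity>w\<in>(*) c ` A - {0}. 1 / w ^ k) = (\<Sum>\<^sub>\<infinity>w\<in>A - {0}. 1 / c ^ k * (1 / w ^ k))"
    by (rule infsum_reindex_bij_witness[of _ "\<lambda>w. c * w" "\<lambda>w. w / c"])
       (use assms in \<open>auto simp: power_mult_distrib power_divide\<close>)
  then show ?thesis by (simp only: infsum_cmult_right') simp
qed

lemma wp_g2_scale: "c \<noteq> 0 \<Longrightarrow> wp_g2 ((*) c ` A) = wp_g2 A / c ^ 4"
  by (simp add: wp_g2_def infsum_power_scale)

lemma wp_g3_scale: "c \<noteq> 0 \<Longrightarrow> wp_g3 ((*) c ` A) = wp_g3 A / c ^ 6"
  by (simp add: wp_g3_def infsum_power_scale)

text \<open>The vertical half-period is treated as the horizontal one of the lattice rotated by a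
  right angle, which is the second instance of the locale. Since i^4 = 1 and i^6 = -1, only the
  third invariant changes, by its sign.\<close>

lemma half_periods_eq:
  fixes k l a b :: real
  assumes k: "0 < k" "k < 1" and l: "0 < l" and kl: "k\<^sup>2 + l\<^sup>2 = 1" and ab: "0 < a" "0 < b"
    and g2: "wp_g2 (lattice (2 * complex_of_real a) (2 * (\<i> * complex_of_real b))) = of_real (4/27 * (8 * l\<^sup>2 + 1))"
    and g3: "wp_g3 (lattice (2 * complex_of_real a) (2 * (\<i> * complex_of_real b)))
               = of_real (8/729 * (8 * l ^ 4 + 20 * l\<^sup>2 - 1))"
  shows "a = pi / 2 * hyp2F1 (1/3) (2/3) 1 (k\<^sup>2)"
    and "b = sqrt 3 * (pi / 2 * hyp2F1 (1/3) (2/3) 1 (l\<^sup>2))"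
proof -
  interpret R: rect_lattice a b by unfold_locales (use ab in auto)
  interpret R': rect_lattice b a by unfold_locales (use ab in auto)
  define t where "t = k\<^sup>2 / 27"
  have l2: "l\<^sup>2 = 1 - 27 * t" using kl by (simp add: t_def)
  have "l ^ 4 = (l\<^sup>2)\<^sup>2" by (simp flip: power_mult)
  then have l4: "l ^ 4 = (1 - 27 * t)\<^sup>2" unfolding l2 .
  have G: "R.G2 = 4/27 * (9 - 216 * t)" "R.G3 = 8/729 * (27 - 972 * t + 5832 * t\<^sup>2)"
    unfolding R.G2_def R.G3_def R.L_def g2 g3 l2 l4
    by (simp_all add: power2_eq_square algebra_simps)
  have rot: "R'.L = (*) \<i> ` R.L"
  proof -
    have "(*) \<i> ` R.L = lattice (2 * (\<i> * complex_of_real a)) (- (2 * complex_of_real b))"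
      unfolding R.L_def lattice_scale by (simp add: algebra_simps)
    also have "\<dots> = R'.L"
    proof -
      have "of_int m * w + of_int n * - v = of_int (- n) * v + of_int m * w"
        "of_int m * v + of_int n * w = of_int n * w + of_int (- m) * - v" for m n and v w :: complex by simp_all
      then show ?thesis unfolding R'.L_def lattice_def by blast
    qed
    finally show ?thesis ..
  qed
  have G': "R'.G2 = R.G2" "R'.G3 = - R.G3"
    unfolding R'.G2_def R'.G3_def rot R.G2_def R.G3_def
    by (simp_all add: wp_g2_scale wp_g3_scale power_numeral_reduce)
  have cubic: "4 * (4 * v - 1/3) ^ 3 - R.G2 * (4 * v - 1/3) - R.G3 = 64 * (4 * v ^ 3 - (v - t)\<^sup>2)" for v
    unfolding G by (simp add: power2_eq_square power3_eq_cube field_simps)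
  \<comment> \<open>This is \<open>cubic\<close> at \<open>v = - x\<close> with the sign reversed,
    matching the change of sign of \<open>G3\<close>.\<close>
  have cubic': "4 * (4 * x + 1/3) ^ 3 - R.G2 * (4 * x + 1/3) + R.G3 = 64 * (4 * x ^ 3 + (x + t)\<^sup>2)" for x
    unfolding G by (simp add: power2_eq_square power3_eq_cube field_simps)
  \<comment> \<open>The 8, divided by the 4 of the substitution, is the factor 2 in the speed of
    both motions; hence \<open>c = 1\<close> for the first.\<close>
  have s64: "sqrt (64 * y) = 8 * sqrt y" for y
    using real_sqrt_mult[of "8 * 8" y] by simp
  define v where "v u = (R.X u + 1/3) / 4" for u
  have vX: "R.X u = 4 * v u - 1/3" for u by (simp add: v_def field_simps)
  have c1: "4 * R.X u ^ 3 - R.G2 * R.X u - R.G3 = 64 * (4 * v u ^ 3 - (v u - k\<^sup>2 / 27)\<^sup>2)" for u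
    unfolding vX cubic t_def ..
  have "1 * a = pi / 2 * hyp2F1 (1/3) (2/3) 1 (k\<^sup>2)"
  proof (rule time_to_turning_point[where v = v])
    show "continuous_on {0<..a} v" unfolding v_def by (intro continuous_intros R.X_cont) auto
    show "4 * v a ^ 3 = (v a - k\<^sup>2 / 27)\<^sup>2" using R.X_end unfolding c1 by simp
    have "filterlim (\<lambda>u. 1/4 * (1/3 + R.X u)) at_top (at_right 0)"
      by (rule filterlim_tendsto_pos_mult_at_top[OF tendsto_const _
            filterlim_tendsto_add_at_top[OF tendsto_const R.X_at_top]]) simp
    then show "filterlim v at_top (at_right 0)" by (simp add: v_def[abs_def] add.commute)
    fix u assume u: "0 < u" "u < a"
    show "(v u - k\<^sup>2 / 27)\<^sup>2 < 4 * v u ^ 3" using R.X_motion(2)[OF u] unfolding c1 by simp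
    from R.X_motion(1)[OF u]
    have "(v has_real_derivative (- sqrt (4 * R.X u ^ 3 - R.G2 * R.X u - R.G3)) / 4) (at u)"
      unfolding v_def[abs_def] by (auto intro!: derivative_eq_intros)
    then show "(v has_real_derivative - 2 * 1 * sqrt (4 * v u ^ 3 - (v u - k\<^sup>2 / 27)\<^sup>2)) (at u)"
      unfolding c1 s64 by simp
  qed (use k ab in auto)
  then show "a = pi / 2 * hyp2F1 (1/3) (2/3) 1 (k\<^sup>2)" by simp
  define x where "x u = (R'.X u - 1/3) / 4" for u
  have xX: "R'.X u = 4 * x u + 1/3" for u by (simp add: x_def field_simps)
  have c2: "4 * R'.X u ^ 3 - R'.G2 * R'.X u - R'.G3 = 64 * (4 * x u ^ 3 + (x u + k\<^sup>2 / 27)\<^sup>2)" for u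
    using cubic'[of "x u"] unfolding xX G' t_def by simp
  show "b = sqrt 3 * (pi / 2 * hyp2F1 (1/3) (2/3) 1 (l\<^sup>2))"
  proof (rule time_to_turning_point_isogeny[where x = x, OF k(1) l kl ab(2)])
    show "continuous_on {0<..b} x" unfolding x_def by (intro continuous_intros R'.X_cont) auto
    show "4 * x b ^ 3 + (x b + k\<^sup>2 / 27)\<^sup>2 = 0" using R'.X_end unfolding c2 by simp
    have "filterlim (\<lambda>u. 1/4 * (- 1/3 + R'.X u)) at_top (at_right 0)"
      by (rule filterlim_tendsto_pos_mult_at_top[OF tendsto_const _
            filterlim_tendsto_add_at_top[OF tendsto_const R'.X_at_top]]) simp
    then show "filterlim x at_top (at_right 0)" by (simp add: x_def[abs_def] add.commute)
    fix u assume u: "0 < u" "u < b"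
    show "0 < 4 * x u ^ 3 + (x u + k\<^sup>2 / 27)\<^sup>2" using R'.X_motion(2)[OF u] unfolding c2 by simp
    from R'.X_motion(1)[OF u]
    have "(x has_real_derivative (- sqrt (4 * R'.X u ^ 3 - R'.G2 * R'.X u - R'.G3)) / 4) (at u)"
      unfolding x_def[abs_def] by (auto intro!: derivative_eq_intros)
    then show "(x has_real_derivative - 2 * sqrt (4 * x u ^ 3 + (x u + k\<^sup>2 / 27)\<^sup>2)) (at u)"
      unfolding c2 s64 by simp
  qed
qed

section \<open>Existence of the lattice\<close>

lemma hyp2F1_mono_pos:
  fixes x y :: real
  assumes "0 \<le> x" "x < y" "y < 1"
  shows "hyp2F1 (1/3) (2/3) 1 x < hyp2F1 (1/3) (2/3) 1 y" "0 < hyp2F1 (1/3) (2/3) 1 x"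
proof -
  define c where "c n = pochhammer (1/3) n * pochhammer (2/3) n / (pochhammer 1 n * fact n :: real)" for n
  have pos: "0 < c n" for n
    unfolding c_def by (intro divide_pos_pos mult_pos_pos pochhammer_pos) auto
  have le: "c n \<le> 1" for n
  proof (induction n)
    case (Suc n)
    have "c (Suc n) = c n * ((real n + 1/3) * (real n + 2/3) / ((real n + 1) * (real n + 1)))"
      unfolding c_def pochhammer_Suc fact_Suc by (simp add: add_ac mult_ac)
    also have "\<dots> \<le> c n * 1"
      using pos[of n] by (intro mult_left_mono) (auto simp: divide_le_eq_1 algebra_simps add_pos_nonneg)
    finally show ?case using Suc by simp
  qed (simp add: c_def)
  have sm: "summable (\<lambda>n. c n * z ^ n)" if "0 \<le> z" "z < 1" for z
  proof (rule summable_comparison_test'[of "\<lambda>n. z ^ n" 0])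
    show "summable (\<lambda>n. z ^ n)" using that by (intro summable_geometric) simp
    show "norm (c n * z ^ n) \<le> z ^ n" for n
      using le[of n] pos[of n] that by (simp add: abs_mult mult_left_le_one_le)
  qed
  have F: "hyp2F1 (1/3) (2/3) 1 z = (\<Sum>n. c n * z ^ n)" for z by (simp add: hyp2F1_def c_def)
  have "0 < (\<Sum>n. c n * y ^ n - c n * x ^ n)"
  proof (rule suminf_pos2[where i = 1])
    show "summable (\<lambda>n. c n * y ^ n - c n * x ^ n)" using assms by (intro summable_diff sm) auto
    show "0 \<le> c n * y ^ n - c n * x ^ n" for n
      using pos[of n] assms by (simp add: mult_left_mono power_mono)
    show "0 < c 1 * y ^ 1 - c 1 * x ^ 1" using pos[of 1] assms by simp
  qed
  then show "hyp2F1 (1/3) (2/3) 1 x < hyp2F1 (1/3) (2/3) 1 y"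
    unfolding F using suminf_diff[OF sm[of y] sm[of x]] assms by simp
  show "0 < hyp2F1 (1/3) (2/3) 1 x"
    unfolding F
    by (rule suminf_pos2[where i = 0]) (use sm assms pos in \<open>auto intro!: mult_nonneg_nonneg intro: less_imp_le\<close>)
qed

text \<open>The quotient of \<open>q\<close> by \<open>sqrt p ^ 3\<close> is unchanged by positive
  scaling and, unlike its square, remembers the sign of \<open>q\<close>. Along the family it runs
  continuously between the two values with square 1/27, the limits of positive discriminant, so it
  attains every admissible value; \<open>s\<close> then adjusts the size.\<close>

lemma invariants_normal_form:
  fixes p q :: real
  assumes p: "0 < p" and d: "27 * q\<^sup>2 < p ^ 3"
  obtains m s where "0 < m" "m < 1" "0 < s"
    "p = s ^ 4 * (4/27 * (8 * m + 1))" "q = s ^ 6 * (8/729 * (8 * m\<^sup>2 + 20 * m - 1))"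
proof -
  define J where "J m = 8/729 * (8 * m\<^sup>2 + 20 * m - 1) / sqrt (4/27 * (8 * m + 1)) ^ 3" for m :: real
  define j where "j = q / sqrt p ^ 3"
  have sq: "(sqrt z ^ 3)\<^sup>2 = z ^ 3" if "0 \<le> z" for z :: real
    using that by (metis power_mult mult.commute real_sqrt_pow2)
  have "j\<^sup>2 = q\<^sup>2 / p ^ 3" unfolding j_def power_divide sq[OF less_imp_le[OF p]] ..
  then have j2: "j\<^sup>2 < 1 / 27" using p d by (simp only:) (simp add: field_simps)
  have J2: "(J m)\<^sup>2 = (8/729 * (8 * m\<^sup>2 + 20 * m - 1))\<^sup>2 / (4/27 * (8 * m + 1)) ^ 3" if "0 \<le> m" for m
  proof -
    have nonneg: "0 \<le> 4/27 * (8 * m + 1)" using that by simp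
    show ?thesis unfolding J_def power_divide sq[OF nonneg] ..
  qed
  have J0: "(J 0)\<^sup>2 = 1 / 27" unfolding J2[OF order_refl] by (simp add: power2_eq_square power3_eq_cube)
  have J1: "(J 1)\<^sup>2 = 1 / 27" unfolding J2[OF zero_le_one] by (simp add: power2_eq_square power3_eq_cube)
  have Jsgn: "J 0 < 0" "0 < J 1" by (simp_all add: J_def divide_neg_pos)
  have "\<bar>j\<bar> < \<bar>J 0\<bar>" "\<bar>j\<bar> < \<bar>J 1\<bar>"
    using j2 J0 J1 abs_le_square_iff[of "J 0" j] abs_le_square_iff[of "J 1" j] by linarith+
  then have jJ: "J 0 < j" "j < J 1" using Jsgn by linarith+
  have "\<exists>m\<ge>0. m \<le> 1 \<and> J m = j"
    using jJ unfolding J_def by (intro IVT') (auto intro!: continuous_intros)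
  then obtain m where m: "0 \<le> m" "m \<le> 1" "J m = j" by blast
  have m01: "0 < m" "m < 1" using m jJ by (auto simp: less_le)
  define D where "D = 4/27 * (8 * m + 1)"
  have D: "0 < D" using m by (simp add: D_def)
  define s where "s = sqrt (sqrt (p / D))"
  have s: "0 < s" using p D by (simp add: s_def)
  have s2: "s\<^sup>2 = sqrt (p / D)" using p D by (simp add: s_def)
  have s4: "s ^ 4 = p / D" using p D s2 by (metis power2_eq_square power4_eq_xxxx mult.assoc real_sqrt_mult_self abs_of_pos divide_pos_pos)
  have "s ^ 6 = (s\<^sup>2) ^ 3" by (simp flip: power_mult)
  then have s6: "s ^ 6 = sqrt p ^ 3 / sqrt D ^ 3" by (simp add: s2 real_sqrt_divide power_divide)
  show ?thesis
  proof (rule that[OF m01 s])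
    show "p = s ^ 4 * (4/27 * (8 * m + 1))" using s4 D by (simp add: D_def)
    have N: "8/729 * (8 * m\<^sup>2 + 20 * m - 1) = j * sqrt D ^ 3"
      using m(3) D unfolding J_def D_def[symmetric] by (simp add: field_simps)
    show "q = s ^ 6 * (8/729 * (8 * m\<^sup>2 + 20 * m - 1))"
      unfolding N s6 j_def using p D by simp
  qed
qed

text \<open>By \<open>half_periods_eq\<close> the ratio of the half-periods determines \<open>k\<close> because the hypergeometric
  function is increasing. Hence the rectangle with the predicted sides must have the right invariants.\<close>

lemma half_periods_invariants:
  fixes k l :: real
  assumes k: "0 < k" "k < 1" and l: "0 < l" and kl: "k\<^sup>2 + l\<^sup>2 = 1"
  defines "a \<equiv> pi / 2 * hyp2F1 (1/3) (2/3) 1 (k\<^sup>2)"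
    and "b \<equiv> sqrt 3 * (pi / 2 * hyp2F1 (1/3) (2/3) 1 (l\<^sup>2))"
  shows "0 < a" "0 < b"
    "wp_g2 (lattice (2 * complex_of_real a) (2 * (\<i> * complex_of_real b))) = of_real (4/27 * (8 * l\<^sup>2 + 1))"
    "wp_g3 (lattice (2 * complex_of_real a) (2 * (\<i> * complex_of_real b)))
               = of_real (8/729 * (8 * l ^ 4 + 20 * l\<^sup>2 - 1))"
proof -
  let ?F = "hyp2F1 (1/3) (2/3) 1"
  have k2: "0 < k\<^sup>2" "0 < l\<^sup>2" "k\<^sup>2 < 1" "l\<^sup>2 < 1"
  proof -
    show "0 < k\<^sup>2" "0 < l\<^sup>2" using k l by auto
    then show "k\<^sup>2 < 1" "l\<^sup>2 < 1" using kl by linarith+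
  qed
  have Fpos: "0 < ?F x" if "0 < x" "x < 1" for x
    using hyp2F1_mono_pos(2)[of x "(x + 1) / 2"] that by simp
  show ab: "0 < a" "0 < b" unfolding a_def b_def using Fpos k2 by auto
  interpret R: rect_lattice a b by unfold_locales (use ab in auto)
  obtain m s where ms: "0 < m" "m < 1" "0 < s"
    "R.G2 = s ^ 4 * (4/27 * (8 * m + 1))" "R.G3 = s ^ 6 * (8/729 * (8 * m\<^sup>2 + 20 * m - 1))"
    using invariants_normal_form[OF R.G2_pos R.discriminant_pos] by blast
  \<comment> \<open>Stretching by \<open>s\<close> divides the invariants by its fourth and sixth
    powers, which brings them into the normal form with parameter \<open>m\<close>.\<close>
  have sL: "lattice (2 * complex_of_real (s * a)) (2 * (\<i> * complex_of_real (s * b))) = (*) (of_real s) ` R.L"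
    unfolding R.L_def lattice_scale by (simp add: mult_ac)
  have sc: "wp_g2 ((*) (of_real s) ` R.L) = of_real (4/27 * (8 * m + 1))"
    "wp_g3 ((*) (of_real s) ` R.L) = of_real (8/729 * (8 * m\<^sup>2 + 20 * m - 1))"
    using ms(3) by (simp_all add: wp_g2_scale wp_g3_scale R.g_real ms(4,5))
  define k' l' where "k' = sqrt (1 - m)" and "l' = sqrt m"
  have kl': "0 < k'" "k' < 1" "0 < l'" "k'\<^sup>2 + l'\<^sup>2 = 1" "l'\<^sup>2 = m" "k'\<^sup>2 = 1 - m" "l' ^ 4 = m\<^sup>2"
    using ms by (auto simp: k'_def l'_def real_sqrt_lt_1_iff power4_eq_xxxx power2_eq_square)
  have "s * a = pi / 2 * ?F (k'\<^sup>2)" "s * b = sqrt 3 * (pi / 2 * ?F (l'\<^sup>2))"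
    using half_periods_eq[OF kl'(1,2,3,4), of "s * a" "s * b"] ab ms(3) unfolding sL sc kl'(5,7) by auto
  then have sF: "s * ?F (k\<^sup>2) = ?F (1 - m)" "s * ?F (l\<^sup>2) = ?F m"
    unfolding a_def b_def kl' by auto
  \<comment> \<open>In \<open>sF\<close> the same \<open>s\<close> links arguments that move in
    opposite directions: if the squares differed, one equation would give \<open>s > 1\<close> and
    the other \<open>s < 1\<close>.\<close>
  have lm: "l\<^sup>2 = m"
  proof (rule linorder_cases[of "l\<^sup>2" m])
    assume lt: "l\<^sup>2 < m"
    then have "?F (l\<^sup>2) < ?F m" using k2 ms by (intro hyp2F1_mono_pos) auto
    then have "1 * ?F (l\<^sup>2) < s * ?F (l\<^sup>2)" using sF by simp
    then have "1 < s" using Fpos k2 by (simp add: mult_less_cancel_right)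
    have "?F (1 - m) < ?F (k\<^sup>2)" using lt kl k2 ms by (intro hyp2F1_mono_pos) auto
    then have "s * ?F (k\<^sup>2) < 1 * ?F (k\<^sup>2)" using sF by simp
    then have "s < 1" using Fpos[of "k\<^sup>2"] k2 by (simp only: mult_less_cancel_right_pos)
    with \<open>1 < s\<close> show ?thesis by simp
  next
    assume lt: "m < l\<^sup>2"
    then have "?F m < ?F (l\<^sup>2)" using k2 ms by (intro hyp2F1_mono_pos) auto
    then have "s * ?F (l\<^sup>2) < 1 * ?F (l\<^sup>2)" using sF by simp
    then have "s < 1" using Fpos[of "l\<^sup>2"] k2 by (simp only: mult_less_cancel_right_pos)
    have "?F (k\<^sup>2) < ?F (1 - m)" using lt kl k2 ms by (intro hyp2F1_mono_pos) auto
    then have "1 * ?F (k\<^sup>2) < s * ?F (k\<^sup>2)" using sF by simp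
    then have "1 < s" using Fpos[of "k\<^sup>2"] k2 by (simp only: mult_less_cancel_right_pos)
    with \<open>s < 1\<close> show ?thesis by simp
  qed
  then have "s = 1" using sF(2) Fpos[of m] ms by simp
  moreover have "l ^ 4 = (l\<^sup>2)\<^sup>2" by (simp flip: power_mult)
  then have "l ^ 4 = m\<^sup>2" unfolding lm .
  ultimately show
    "wp_g2 (lattice (2 * complex_of_real a) (2 * (\<i> * complex_of_real b))) = of_real (4/27 * (8 * l\<^sup>2 + 1))"
    "wp_g3 (lattice (2 * complex_of_real a) (2 * (\<i> * complex_of_real b)))
               = of_real (8/729 * (8 * l ^ 4 + 20 * l\<^sup>2 - 1))"
    using R.g_real unfolding R.L_def ms(4,5) lm by simp_all
qed

theorem theorem10:
  fixes \<kappa> :: real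
  assumes "0 < \<kappa>" "\<kappa> < 1"
  defines "lam \<equiv> sqrt (1 - \<kappa>^2)"
  defines "g2 \<equiv> complex_of_real (4/27 * (8 * lam^2 + 1))"
  defines "g3 \<equiv> complex_of_real (8/729 * (8 * lam^4 + 20 * lam^2 - 1))"
  shows "(\<exists>\<omega> \<omega>'. 0 < \<omega> \<and> Re \<omega>' = 0 \<and> 0 < Im \<omega>' \<and>
            is_period_lattice_of_wp g2 g3 (lattice (2 * complex_of_real \<omega>) (2 * \<omega>')))
       \<and> (\<forall>\<omega> \<omega>'. 0 < \<omega> \<and> Re \<omega>' = 0 \<and> 0 < Im \<omega>' \<and>
            is_period_lattice_of_wp g2 g3 (lattice (2 * complex_of_real \<omega>) (2 * \<omega>'))
          \<longrightarrow> \<omega> = 1/2 * pi * hyp2F1 (1/3) (2/3) 1 (\<kappa>^2)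
            \<and> \<omega>' = \<i> * complex_of_real (sqrt 3 / 2 * pi * hyp2F1 (1/3) (2/3) 1 (lam^2)))"
proof -
  have "\<kappa>\<^sup>2 < 1" using assms by (simp add: abs_square_less_1)
  then have lam: "0 < lam" "\<kappa>\<^sup>2 + lam\<^sup>2 = 1" by (simp_all add: lam_def)
  define a where "a = pi / 2 * hyp2F1 (1/3) (2/3) 1 (\<kappa>\<^sup>2)"
  define b where "b = sqrt 3 * (pi / 2 * hyp2F1 (1/3) (2/3) 1 (lam\<^sup>2))"
  note inv = half_periods_invariants[OF assms(1,2) lam, folded a_def b_def]
  have "Im (2 * (\<i> * complex_of_real b) / (2 * complex_of_real a)) \<noteq> 0"
    using inv(1,2) by (simp add: Im_divide_of_real)
  then have "is_period_lattice_of_wp g2 g3 (lattice (2 * complex_of_real a) (2 * (\<i> * complex_of_real b)))"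
    unfolding is_period_lattice_of_wp_def g2_def g3_def using inv(3,4) by blast
  moreover have "Re (\<i> * complex_of_real b) = 0" "0 < Im (\<i> * complex_of_real b)" using inv(2) by auto
  moreover have "\<omega> = 1/2 * pi * hyp2F1 (1/3) (2/3) 1 (\<kappa>\<^sup>2)
        \<and> \<omega>' = \<i> * complex_of_real (sqrt 3 / 2 * pi * hyp2F1 (1/3) (2/3) 1 (lam\<^sup>2))"
    if "0 < \<omega>" "Re \<omega>' = 0" "0 < Im \<omega>'"
      "is_period_lattice_of_wp g2 g3 (lattice (2 * complex_of_real \<omega>) (2 * \<omega>'))" for \<omega> \<omega>'
  proof -
    have w: "\<omega>' = \<i> * complex_of_real (Im \<omega>')" using that(2) by (simp add: complex_eq_iff)
    have "wp_g2 (lattice (2 * complex_of_real \<omega>) (2 * (\<i> * complex_of_real (Im \<omega>')))) = g2"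
      "wp_g3 (lattice (2 * complex_of_real \<omega>) (2 * (\<i> * complex_of_real (Im \<omega>')))) = g3"
      using that(4) w by (simp_all add: is_period_lattice_of_wp_def)
    note eq = half_periods_eq[OF assms(1,2) lam that(1,3) this[unfolded g2_def g3_def]]
    from eq(1) have "\<omega> = 1/2 * pi * hyp2F1 (1/3) (2/3) 1 (\<kappa>\<^sup>2)" by simp
    moreover have "\<omega>' = \<i> * complex_of_real (sqrt 3 / 2 * pi * hyp2F1 (1/3) (2/3) 1 (lam\<^sup>2))"
      by (subst w, subst eq(2)) simp
    ultimately show ?thesis ..
  qed
  ultimately show ?thesis using inv(1) by blast
qed

end
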